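(* Let $X\subset\mathbb{P}^N$ be an irreducible reduced hypersurface of degree $d\geq 3$ over $\mathbb{C}$, and let $\Lambda$ be an irreducible component of the closure of the locus of star points on $X$. Then $\Lambda$ is a linear subspace of $\mathbb{P}^N$ of some dimension $0\leq \lambda\leq N-2$, and there is a hyperplane $\Pi$ in $\mathbb{P}^N$ containing $\Lambda$ such that $\Pi\cap X$ is a cone in $\Pi$ with vertex $\Lambda$. In particular, $\Pi$ is the tangent space to $X$ at all smooth points of $X$ contained in $\Lambda$. Moreover, if $\dim(\Lambda)=N-2$, then $\Pi\cap X$ is equal to $d\Lambda$ as a divisor on $\Pi$.
   Context: The ground field is $\mathbb{C}$. A smooth point $P$ of an irreducible reduced hypersurface $X\subset\mathbb{P}^N$ of degree $d\geq 3$ is called a star point on $X$ if the scheme $T_P(X)\cap X$ is a cone with vertex $P$, where $T_P(X)\subset\mathbb{P}^N$ is the embedded tangent hyperplane to $X$ at $P$. For a hyperplane $\Pi$ and a linear subspace $\Lambda\subset\Pi$ of dimension $\lambda$, the scheme $\Pi\cap X$ is a cone with vertex $\Lambda$ if, in homogeneous coordinates $(Y_0:\dots:Y_{N-1})$ on $\Pi$ for which $\Lambda$ is given by $Y_{\lambda+1}=\dots=Y_{N-1}=0$, the scheme $\Pi\cap X$ is defined in $\Pi$ by a nonzero form of degree $d$ involving only the variables $Y_{\lambda+1},\dots,Y_{N-1}$; for $\lambda=0$ this says that $\Pi\cap X$ is a cone with vertex a point. The closure is the Zariski closure. *)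

theory Defs
  imports
    "HOL-Analysis.Analysis"
    "HOL-Library.Poly_Mapping"
    "HOL-Computational_Algebra.Factorial_Ring"
begin

section \<open>Polynomials over the complex numbers\<close>

text \<open>
  A polynomial maps exponent vectors to coefficients.  With \<open>'v\<close> the finite index type of
  the homogeneous coordinates this is exactly the homogeneous coordinate ring of projective space,
  and \<^const>\<open>irreducible\<close> is irreducibility in that ring.  With \<open>'v = nat\<close> it is
  used for coordinates \<open>Y\<^sub>0, Y\<^sub>1, \<dots>\<close> on a hyperplane.
\<close>

type_synonym 'v cpoly = "('v \<Rightarrow>\<^sub>0 nat) \<Rightarrow>\<^sub>0 complex"

definition const :: "complex \<Rightarrow> 'v cpoly" where
  "const c = Poly_Mapping.single 0 c"

definition Var :: "'v \<Rightarrow> 'v cpoly" where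
  "Var i = Poly_Mapping.single (Poly_Mapping.single i 1) 1"

definition vars :: "'v cpoly \<Rightarrow> 'v set" where
  "vars p = (\<Union>m\<in>Poly_Mapping.keys p. Poly_Mapping.keys m)"

definition peval :: "'v cpoly \<Rightarrow> ('v \<Rightarrow> complex) \<Rightarrow> complex" where
  "peval p x = (\<Sum>m\<in>Poly_Mapping.keys p. Poly_Mapping.lookup p m *
     (\<Prod>i\<in>Poly_Mapping.keys m. x i ^ Poly_Mapping.lookup m i))"

definition psubst :: "'v cpoly \<Rightarrow> ('v \<Rightarrow> 'w cpoly) \<Rightarrow> 'w cpoly" where
  "psubst p g = (\<Sum>m\<in>Poly_Mapping.keys p. const (Poly_Mapping.lookup p m) *
     (\<Prod>i\<in>Poly_Mapping.keys m. g i ^ Poly_Mapping.lookup m i))"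

definition partial_deriv :: "'v \<Rightarrow> 'v cpoly \<Rightarrow> 'v cpoly" where
  "partial_deriv i p = (\<Sum>m\<in>Poly_Mapping.keys p.
     Poly_Mapping.single (m - Poly_Mapping.single i 1)
       (of_nat (Poly_Mapping.lookup m i) * Poly_Mapping.lookup p m))"

text \<open>The zero polynomial is homogeneous of every degree.\<close>

definition homogeneous :: "nat \<Rightarrow> 'v cpoly \<Rightarrow> bool" where
  "homogeneous d p \<longleftrightarrow>
     (\<forall>m\<in>Poly_Mapping.keys p. (\<Sum>i\<in>Poly_Mapping.keys m. Poly_Mapping.lookup m i) = d)"

text \<open>
  Two nonzero forms of the same degree define the same closed subscheme of a projective space, and
  the same effective divisor on it, iff they differ by a nonzero scalar factor.
\<close>

definition same_zero_scheme :: "'v cpoly \<Rightarrow> 'v cpoly \<Rightarrow> bool" where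
  "same_zero_scheme p q \<longleftrightarrow> (\<exists>c. c \<noteq> 0 \<and> p = const c * q)"


section \<open>Projective space and its Zariski topology\<close>

text \<open>Points are the lines through the origin, so \<open>\<bbbP>\<^sup>N\<close> has \<open>CARD('n) = N + 1\<close>.\<close>

definition proj_space :: "(complex ^ 'n) set set" where
  "proj_space = {L. vec.subspace L \<and> vec.dim L = 1}"

definition proj_zeros :: "'n::finite cpoly set \<Rightarrow> (complex ^ 'n) set set" where
  "proj_zeros S = {L \<in> proj_space. \<forall>f\<in>S. \<forall>v\<in>L. peval f (($) v) = 0}"

definition zariski :: "(complex ^ 'n::finite) set topology" where
  "zariski = topology (\<lambda>U. \<exists>S. (\<forall>f\<in>S. \<exists>d. homogeneous d f) \<and> U = proj_space - proj_zeros S)"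

definition irreducible_subset :: "'a topology \<Rightarrow> 'a set \<Rightarrow> bool" where
  "irreducible_subset T Z \<longleftrightarrow> Z \<subseteq> topspace T \<and> Z \<noteq> {} \<and>
     (\<forall>A B. closedin T A \<and> closedin T B \<and> Z \<subseteq> A \<union> B \<longrightarrow> Z \<subseteq> A \<or> Z \<subseteq> B)"

definition irreducible_component :: "'a topology \<Rightarrow> 'a set \<Rightarrow> 'a set \<Rightarrow> bool" where
  "irreducible_component T S Z \<longleftrightarrow> Z \<subseteq> S \<and> irreducible_subset T Z \<and>
     (\<forall>Z'. Z' \<subseteq> S \<and> irreducible_subset T Z' \<and> Z \<subseteq> Z' \<longrightarrow> Z' = Z)"

definition linear_subspace :: "nat \<Rightarrow> (complex ^ 'n::finite) set set \<Rightarrow> bool" where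
  "linear_subspace k \<Lambda> \<longleftrightarrow>
     (\<exists>V. vec.subspace V \<and> vec.dim V = k + 1 \<and> \<Lambda> = {L \<in> proj_space. L \<subseteq> V})"

definition hyperplane :: "(complex ^ 'n::finite) set set \<Rightarrow> bool" where
  "hyperplane H \<longleftrightarrow>
     (\<exists>V. vec.subspace V \<and> vec.dim V + 1 = CARD('n) \<and> H = {L \<in> proj_space. L \<subseteq> V})"


section \<open>Homogeneous coordinates on a hyperplane\<close>

text \<open>
  A choice of homogeneous coordinates \<open>Y\<^sub>0, \<dots>, Y\<^bsub>N-1\<^esub>\<close> on a hyperplane is given by the dual
  basis \<open>b\<close> of the underlying vector space: the vector \<open>\<Sum>j<N. y j *s b j\<close> has coordinates \<open>y\<close>.
  Here \<open>N\<close> is \<open>CARD('n) - 1\<close>.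
\<close>

definition coordinates_on ::
    "(complex ^ 'n::finite) set set \<Rightarrow> (nat \<Rightarrow> complex ^ 'n) \<Rightarrow> bool" where
  "coordinates_on H b \<longleftrightarrow>
     inj_on b {..<CARD('n) - 1} \<and> vec.independent (b ` {..<CARD('n) - 1}) \<and>
     H = {L \<in> proj_space. L \<subseteq> vec.span (b ` {..<CARD('n) - 1})}"

definition zeros_on :: "(complex ^ 'n::finite) set set \<Rightarrow> (nat \<Rightarrow> complex ^ 'n) \<Rightarrow>
    nat cpoly set \<Rightarrow> (complex ^ 'n) set set" where
  "zeros_on H b S =
     {L \<in> H. \<forall>y. (\<Sum>j<CARD('n) - 1. y j *s b j) \<in> L \<longrightarrow> (\<forall>f\<in>S. peval f y = 0)}"

text \<open>
  The equation \<open>F(\<Sum>j<N. Y\<^sub>j b\<^sub>j)\<close> of the scheme-theoretic intersection of the hyperplane with the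
  hypersurface \<open>F = 0\<close>.
\<close>

definition restrict_form ::
    "'n::finite cpoly \<Rightarrow> (nat \<Rightarrow> complex ^ 'n) \<Rightarrow> nat cpoly" where
  "restrict_form F b = psubst F (\<lambda>i. \<Sum>j<CARD('n) - 1. const (b j $ i) * Var j)"

definition is_cone_with_vertex :: "nat \<Rightarrow> 'n::finite cpoly \<Rightarrow>
    (complex ^ 'n) set set \<Rightarrow> nat \<Rightarrow> (complex ^ 'n) set set \<Rightarrow> bool" where
  "is_cone_with_vertex d F H k \<Lambda> \<longleftrightarrow>
     (\<exists>b G. coordinates_on H b \<and>
        \<Lambda> = zeros_on H b (Var ` {k<..<CARD('n) - 1}) \<and>
        homogeneous d G \<and> G \<noteq> 0 \<and> vars G \<subseteq> {k<..<CARD('n) - 1} \<and>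
        same_zero_scheme (restrict_form F b) G)"

text \<open>
  Equality of divisors on \<open>H\<close> between the intersection with \<open>F = 0\<close> and \<open>d \<Lambda>\<close>, where \<open>\<Lambda>\<close> is a
  hyperplane of \<open>H\<close> with equation \<open>l\<close>, so that \<open>d \<Lambda>\<close> is the divisor of the form \<open>l ^ d\<close>.
\<close>

definition section_eq_multiple :: "'n::finite cpoly \<Rightarrow>
    (complex ^ 'n) set set \<Rightarrow> nat \<Rightarrow> (complex ^ 'n) set set \<Rightarrow> bool" where
  "section_eq_multiple F H d \<Lambda> \<longleftrightarrow>
     (\<exists>b l. coordinates_on H b \<and>
        homogeneous 1 l \<and> l \<noteq> 0 \<and> vars l \<subseteq> {..<CARD('n) - 1} \<and>
        \<Lambda> = zeros_on H b {l} \<and>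
        same_zero_scheme (restrict_form F b) (l ^ d))"


section \<open>Smooth points, tangent hyperplanes and star points\<close>

text \<open>
  In what follows the hypersurface is the zero scheme of an irreducible form \<open>F\<close>; as \<open>F\<close> is
  homogeneous, the conditions on a representative \<open>v\<close> of a point do not depend on the choice.
\<close>

definition smooth_point :: "'n::finite cpoly \<Rightarrow> (complex ^ 'n) set \<Rightarrow> bool" where
  "smooth_point F P \<longleftrightarrow> P \<in> proj_zeros {F} \<and>
     (\<exists>v\<in>P - {0}. \<exists>i. peval (partial_deriv i F) (($) v) \<noteq> 0)"

definition tangent_hyperplane ::
    "'n::finite cpoly \<Rightarrow> (complex ^ 'n) set \<Rightarrow> (complex ^ 'n) set set" where
  "tangent_hyperplane F P = {Q \<in> proj_space.
     \<forall>v\<in>P - {0}. \<forall>w\<in>Q. (\<Sum>i\<in>UNIV. peval (partial_deriv i F) (($) v) * w $ i) = 0}"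

definition star_point :: "nat \<Rightarrow> 'n::finite cpoly \<Rightarrow> (complex ^ 'n) set \<Rightarrow> bool" where
  "star_point d F P \<longleftrightarrow> smooth_point F P \<and>
     is_cone_with_vertex d F (tangent_hyperplane F P) 0 {P}"


section \<open>The Zariski topology is a topology\<close>

lemma peval_superset:
  assumes "finite S" "Poly_Mapping.keys p \<subseteq> S"
  shows "peval p x = (\<Sum>m\<in>S. Poly_Mapping.lookup p m *
     (\<Prod>i\<in>Poly_Mapping.keys m. x i ^ Poly_Mapping.lookup m i))"
  unfolding peval_def by (rule sum.mono_neutral_left) (use assms in \<open>auto simp: in_keys_iff\<close>)

lemma peval_add: "peval (p + q) x = peval p x + peval q x"
proof -
  let ?S = "Poly_Mapping.keys p \<union> Poly_Mapping.keys q"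
  have "Poly_Mapping.keys (p + q) \<subseteq> ?S" by (rule Poly_Mapping.keys_add)
  then show ?thesis
    by (simp add: peval_superset[of ?S] lookup_add ring_distribs sum.distrib)
qed

lemma peval_zero [simp]: "peval 0 x = 0"
  by (simp add: peval_def)

lemma peval_sum: "peval (sum f A) x = (\<Sum>a\<in>A. peval (f a) x)"
  by (induction A rule: infinite_finite_induct) (auto simp: peval_add)

lemma peval_single: "peval (Poly_Mapping.single m c) x =
   c * (\<Prod>i\<in>Poly_Mapping.keys m. x i ^ Poly_Mapping.lookup m i)"
  by (simp add: peval_def)

lemma monomial_eval_add:
  fixes m n :: "'v \<Rightarrow>\<^sub>0 nat" and x :: "'v \<Rightarrow> complex"
  shows "(\<Prod>i\<in>Poly_Mapping.keys (m + n). x i ^ Poly_Mapping.lookup (m + n) i) =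
    (\<Prod>i\<in>Poly_Mapping.keys m. x i ^ Poly_Mapping.lookup m i) *
    (\<Prod>i\<in>Poly_Mapping.keys n. x i ^ Poly_Mapping.lookup n i)"
proof -
  let ?S = "Poly_Mapping.keys m \<union> Poly_Mapping.keys n"
  have *: "(\<Prod>i\<in>Poly_Mapping.keys k. x i ^ Poly_Mapping.lookup k i) =
      (\<Prod>i\<in>?S. x i ^ Poly_Mapping.lookup k i)" if "Poly_Mapping.keys k \<subseteq> ?S" for k :: "'v \<Rightarrow>\<^sub>0 nat"
    by (rule prod.mono_neutral_left) (use that in \<open>auto simp: in_keys_iff\<close>)
  show ?thesis
    unfolding *[OF Poly_Mapping.keys_add] *[of m, OF Un_upper1] *[of n, OF Un_upper2]
    by (simp add: lookup_add power_add prod.distrib)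
qed

lemma cpoly_eq_sum_single:
  "p = (\<Sum>m\<in>Poly_Mapping.keys p. Poly_Mapping.single m (Poly_Mapping.lookup p m))"
  by (rule poly_mapping_eqI)
     (auto simp: lookup_sum lookup_single when_def in_keys_iff)

lemma peval_mult: "peval (p * q) x = peval p x * peval q x"
proof -
  have "p * q = (\<Sum>m\<in>Poly_Mapping.keys p. Poly_Mapping.single m (Poly_Mapping.lookup p m)) *
      (\<Sum>n\<in>Poly_Mapping.keys q. Poly_Mapping.single n (Poly_Mapping.lookup q n))"
    using cpoly_eq_sum_single[of p] cpoly_eq_sum_single[of q] by simp
  also have "\<dots> = (\<Sum>m\<in>Poly_Mapping.keys p. \<Sum>n\<in>Poly_Mapping.keys q.
      Poly_Mapping.single (m + n) (Poly_Mapping.lookup p m * Poly_Mapping.lookup q n))"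
    by (simp add: sum_product mult_single)
  finally have "peval (p * q) x = (\<Sum>m\<in>Poly_Mapping.keys p. \<Sum>n\<in>Poly_Mapping.keys q.
      peval (Poly_Mapping.single (m + n) (Poly_Mapping.lookup p m * Poly_Mapping.lookup q n)) x)"
    by (simp add: peval_sum)
  also have "\<dots> = peval p x * peval q x"
    unfolding peval_single monomial_eval_add
    unfolding peval_def sum_product by (intro sum.cong refl) (simp only: mult_ac)
  finally show ?thesis .
qed

lemma homogeneous_mult:
  assumes "homogeneous d p" "homogeneous e q"
  shows "homogeneous (d + e) (p * q)"
  unfolding homogeneous_def
proof
  fix k assume "k \<in> Poly_Mapping.keys (p * q)"
  then obtain m n where mn: "m \<in> Poly_Mapping.keys p" "n \<in> Poly_Mapping.keys q" "k = m + n"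
    using Poly_Mapping.keys_mult[of p q] by blast
  let ?S = "Poly_Mapping.keys m \<union> Poly_Mapping.keys n"
  have *: "(\<Sum>i\<in>Poly_Mapping.keys l. Poly_Mapping.lookup l i) = (\<Sum>i\<in>?S. Poly_Mapping.lookup l i)"
    if "Poly_Mapping.keys l \<subseteq> ?S" for l :: "_ \<Rightarrow>\<^sub>0 nat"
    by (rule sum.mono_neutral_left) (use that in \<open>auto simp: in_keys_iff\<close>)
  have "(\<Sum>i\<in>Poly_Mapping.keys k. Poly_Mapping.lookup k i) =
      (\<Sum>i\<in>Poly_Mapping.keys m. Poly_Mapping.lookup m i) +
      (\<Sum>i\<in>Poly_Mapping.keys n. Poly_Mapping.lookup n i)"
    unfolding mn(3) *[OF Poly_Mapping.keys_add] *[of m, OF Un_upper1] *[of n, OF Un_upper2]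
    by (simp add: lookup_add sum.distrib)
  then show "(\<Sum>i\<in>Poly_Mapping.keys k. Poly_Mapping.lookup k i) = d + e"
    using assms mn by (simp add: homogeneous_def)
qed

lemma peval_scale:
  assumes "homogeneous d p"
  shows "peval p (\<lambda>i. c * x i) = c ^ d * peval p x"
  unfolding peval_def sum_distrib_left
proof (rule sum.cong)
  fix m assume "m \<in> Poly_Mapping.keys p"
  then have "(\<Sum>i\<in>Poly_Mapping.keys m. Poly_Mapping.lookup m i) = d"
    using assms by (auto simp: homogeneous_def)
  then have "(\<Prod>i\<in>Poly_Mapping.keys m. c ^ Poly_Mapping.lookup m i) = c ^ d"
    by (metis power_sum)
  then show "Poly_Mapping.lookup p m * (\<Prod>i\<in>Poly_Mapping.keys m. (c * x i) ^ Poly_Mapping.lookup m i) =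
      c ^ d * (Poly_Mapping.lookup p m * (\<Prod>i\<in>Poly_Mapping.keys m. x i ^ Poly_Mapping.lookup m i))"
    by (simp add: power_mult_distrib prod.distrib)
qed simp

lemma proj_space_eq_span:
  "L \<in> proj_space \<longleftrightarrow> (\<exists>u. u \<noteq> 0 \<and> L = vec.span {u :: complex ^ 'n::finite})"
proof
  assume "L \<in> proj_space"
  then have L: "vec.subspace L" "vec.dim L = 1" by (auto simp: proj_space_def)
  then obtain B where B: "B \<subseteq> L" "vec.independent B" "L \<subseteq> vec.span B" "card B = 1"
    using vec.basis_exists[of L] by metis
  then obtain u where u: "B = {u}" by (meson card_1_singletonE)
  have "u \<noteq> 0" using B(2) u by simp
  moreover have "L = vec.span {u}"
    using B(1,3) u vec.span_minimal[OF B(1) L(1)] by simp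
  ultimately show "\<exists>u. u \<noteq> 0 \<and> L = vec.span {u}" by blast
next
  assume "\<exists>u. u \<noteq> 0 \<and> L = vec.span {u}"
  then show "L \<in> proj_space"
    by (auto simp: proj_space_def vec.dim_eq_card_independent)
qed

lemma vanishes_on_span_iff:
  assumes "homogeneous d f"
  shows "(\<forall>v\<in>vec.span {u :: complex ^ 'n::finite}. peval f (($) v) = 0) \<longleftrightarrow> peval f (($) u) = 0"
proof
  assume *: "peval f (($) u) = 0"
  have "($) (c *s u) = (\<lambda>i. c * u $ i)" for c by (simp add: fun_eq_iff)
  then have "peval f (($) (c *s u)) = 0" for c
    using peval_scale[OF assms, of c "($) u"] * by simp
  then show "\<forall>v\<in>vec.span {u}. peval f (($) v) = 0"
    by (auto simp: vec.span_singleton)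
next
  assume "\<forall>v\<in>vec.span {u}. peval f (($) v) = 0"
  moreover have "u \<in> vec.span {u}" by (simp add: vec.span_base)
  ultimately show "peval f (($) u) = 0" by simp
qed

lemma proj_zeros_Un:
  assumes "\<forall>f\<in>S. \<exists>d. homogeneous d f" "\<forall>f\<in>T. \<exists>d. homogeneous d f"
  shows "proj_zeros S \<union> proj_zeros T = proj_zeros {f * g | f g. f \<in> S \<and> g \<in> T}"
proof (rule set_eqI)
  fix L :: "(complex ^ 'a) set"
  show "L \<in> proj_zeros S \<union> proj_zeros T \<longleftrightarrow> L \<in> proj_zeros {f * g | f g. f \<in> S \<and> g \<in> T}"
  proof (cases "L \<in> proj_space")
    case True
    then obtain u where L: "L = vec.span {u}" by (auto simp: proj_space_eq_span)
    have *: "(\<forall>v\<in>L. peval f (($) v) = 0) \<longleftrightarrow> peval f (($) u) = 0" if "\<exists>d. homogeneous d f" for f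
      using that vanishes_on_span_iff unfolding L by blast
    have **: "(\<forall>v\<in>L. peval (f * g) (($) v) = 0) \<longleftrightarrow> peval f (($) u) = 0 \<or> peval g (($) u) = 0"
      if "f \<in> S" "g \<in> T" for f g
    proof -
      have "\<exists>d. homogeneous d (f * g)" using that assms homogeneous_mult by blast
      from *[OF this] show ?thesis by (simp add: peval_mult)
    qed
    have "L \<in> proj_zeros S \<longleftrightarrow> (\<forall>f\<in>S. peval f (($) u) = 0)"
      "L \<in> proj_zeros T \<longleftrightarrow> (\<forall>f\<in>T. peval f (($) u) = 0)"
      using True * assms by (simp_all add: proj_zeros_def)
    moreover have "L \<in> proj_zeros {f * g | f g. f \<in> S \<and> g \<in> T} \<longleftrightarrow>
        (\<forall>f\<in>S. \<forall>g\<in>T. peval f (($) u) = 0 \<or> peval g (($) u) = 0)"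
    proof -
      have "L \<in> proj_zeros {f * g | f g. f \<in> S \<and> g \<in> T} \<longleftrightarrow>
          (\<forall>f\<in>S. \<forall>g\<in>T. \<forall>v\<in>L. peval (f * g) (($) v) = 0)"
        using True by (auto simp: proj_zeros_def)
      then show ?thesis using ** by simp
    qed
    ultimately show ?thesis by blast
  qed (auto simp: proj_zeros_def)
qed

lemma istopology_zariski:
  "istopology (\<lambda>U. \<exists>S. (\<forall>f\<in>S. \<exists>d. homogeneous d f) \<and>
     U = proj_space - proj_zeros (S :: 'n::finite cpoly set))"
  unfolding istopology_def
proof (intro conjI allI impI)
  fix U V :: "(complex ^ 'n) set set"
  assume "\<exists>S. (\<forall>f\<in>S. \<exists>d. homogeneous d f) \<and> U = proj_space - proj_zeros S"
    and "\<exists>S. (\<forall>f\<in>S. \<exists>d. homogeneous d f) \<and> V = proj_space - proj_zeros S"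
  then obtain S T where S: "\<forall>f\<in>S. \<exists>d. homogeneous d f" "U = proj_space - proj_zeros S"
    and T: "\<forall>f\<in>T. \<exists>d. homogeneous d f" "V = proj_space - proj_zeros T" by blast
  have "U \<inter> V = proj_space - proj_zeros {f * g | f g. f \<in> S \<and> g \<in> T}"
    using proj_zeros_Un[OF S(1) T(1)] S T by blast
  moreover have "\<forall>h\<in>{f * g | f g. f \<in> S \<and> g \<in> T}. \<exists>d. homogeneous d h"
    using S(1) T(1) homogeneous_mult by blast
  ultimately show "\<exists>S. (\<forall>f\<in>S. \<exists>d. homogeneous d f) \<and> U \<inter> V = proj_space - proj_zeros S"
    by blast
next
  fix K :: "(complex ^ 'n) set set set"
  assume "\<forall>U\<in>K. \<exists>S. (\<forall>f\<in>S. \<exists>d. homogeneous d f) \<and> U = proj_space - proj_zeros S"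
  then obtain S where S: "\<And>U. U \<in> K \<Longrightarrow> (\<forall>f\<in>S U. \<exists>d. homogeneous d f) \<and> U = proj_space - proj_zeros (S U)"
    by metis
  have "\<Union>K = (\<Union>U\<in>K. proj_space - proj_zeros (S U))" using S by blast
  also have "\<dots> = proj_space - proj_zeros (\<Union>U\<in>K. S U)"
    unfolding proj_zeros_def by blast
  finally show "\<exists>S. (\<forall>f\<in>S. \<exists>d. homogeneous d f) \<and> \<Union>K = proj_space - proj_zeros S"
    using S by (intro exI[of _ "\<Union>U\<in>K. S U"]) blast
qed

lemma openin_zariski:
  "openin zariski U \<longleftrightarrow>
     (\<exists>S. (\<forall>f\<in>S. \<exists>d. homogeneous d f) \<and> U = proj_space - proj_zeros S)"
  unfolding zariski_def topology_inverse'[OF istopology_zariski] ..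

lemma topspace_zariski: "topspace (zariski :: (complex ^ 'n::finite) set topology) = proj_space"
proof -
  have "peval (Poly_Mapping.single 0 1) x = 1" for x :: "'n \<Rightarrow> complex"
    unfolding peval_single by simp
  then have "L \<notin> proj_zeros {Poly_Mapping.single 0 1}" for L :: "(complex ^ 'n) set"
    using vec.span_zero by (auto simp: proj_zeros_def proj_space_eq_span simp del: single_one)
  then have "proj_zeros {Poly_Mapping.single 0 1} = ({} :: (complex ^ 'n) set set)"
    by blast
  moreover have "homogeneous 0 (Poly_Mapping.single 0 1 :: 'n cpoly)"
    by (simp add: homogeneous_def)
  ultimately have "openin zariski (proj_space :: (complex ^ 'n) set set)"
    unfolding openin_zariski by (intro exI[of _ "{Poly_Mapping.single 0 1}"]) auto
  moreover have "topspace zariski \<subseteq> (proj_space :: (complex ^ 'n) set set)"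
    using openin_zariski openin_topspace by blast
  ultimately show ?thesis by (simp add: openin_subset subset_antisym)
qed

lemma closedin_zariski:
  "closedin zariski A \<longleftrightarrow> (\<exists>S. (\<forall>f\<in>S. \<exists>d. homogeneous d f) \<and> A = proj_zeros S)"
proof -
  have "proj_zeros S \<subseteq> proj_space" for S :: "'a cpoly set" by (auto simp: proj_zeros_def)
  then have "A \<subseteq> proj_space \<and> proj_space - A = proj_space - proj_zeros S \<longleftrightarrow> A = proj_zeros S" for S
    by blast
  then show ?thesis
    unfolding closedin_def topspace_zariski openin_zariski by blast
qed

end

theory Submission
  imports Defs "HOL-Computational_Algebra.Fundamental_Theorem_Algebra"
begin

text \<open>
  Write \<open>l\<^sub>p\<close> for the differential of \<open>F\<close> at \<open>p\<close>.  A smooth point \<open>p\<close> is a star point iff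
  \<open>F\<close> restricted to \<open>ker l\<^sub>p\<close> is invariant under translation by \<open>p\<close>.  For a fixed hyperplane \<open>K\<close> the
  vectors with this property form a linear space \<open>W\<^sub>K\<close>, and all smooth points of \<open>W\<^sub>K\<close> are star points
  with tangent hyperplane \<open>K\<close>.  So everything follows once only finitely many \<open>K\<close> are known to occur:
  then the closure of the star locus is a finite union of linear spaces \<open>W\<^sub>K\<close>.

  The hyperplane is locally constant along star points in the classical topology: if star points
  \<open>q\<close> tend to \<open>p\<close> and the normalised differentials \<open>l\<^sub>q\<close> approach \<open>l\<^sub>p\<close> in a direction
  \<open>\<eta>\<close>, then for \<open>w\<close> in \<open>ker l\<^sub>p\<close> the polynomial \<open>(\<eta>(w) + t \<eta>(p)) D\<^sub>u F(w + t p)\<close> in \<open>t\<close> is affine,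
  although its second factor has degree \<open>d - 1 \<ge> 2\<close>; hence \<open>\<eta> = 0\<close>.  Therefore at most countably many
  hyperplanes occur.  If they were infinitely many, a Nullstellensatz over the uncountable field
  \<open>\<complex>\<close>, allowing countably many inequations, would produce a star point outside all the \<open>W\<^sub>K\<close>.
\<close>

section \<open>Polynomials and polynomial functions\<close>

lemma lookup_partial_deriv:
  "Poly_Mapping.lookup (partial_deriv i p) k =
    of_nat (Suc (Poly_Mapping.lookup k i)) * Poly_Mapping.lookup p (k + Poly_Mapping.single i 1)"
proof -
  let ?e = "Poly_Mapping.single i (1::nat)"
  \<comment> \<open>Subtraction of exponents is truncated, so \<open>m - ?e = k\<close> also holds
    for \<open>m = k\<close> when \<open>k\<close> has exponent 0 at \<open>i\<close>; that term
    carries the factor 0, and only \<open>m = k + ?e\<close> contributes.\<close>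
  have shift: "m = k + ?e" if "m - ?e = k" "Poly_Mapping.lookup m i \<noteq> 0" for m
  proof (rule poly_mapping_eqI)
    fix j show "Poly_Mapping.lookup m j = Poly_Mapping.lookup (k + ?e) j"
      using that by (auto simp: lookup_add lookup_minus lookup_single when_def)
  qed
  have "Poly_Mapping.lookup (partial_deriv i p) k = (\<Sum>m\<in>Poly_Mapping.keys p.
      (of_nat (Poly_Mapping.lookup m i) * Poly_Mapping.lookup p m when m - ?e = k))"
    by (simp add: partial_deriv_def lookup_sum lookup_single)
  also have "\<dots> = (\<Sum>m\<in>Poly_Mapping.keys p.
      (of_nat (Poly_Mapping.lookup m i) * Poly_Mapping.lookup p m when m = k + ?e))"
  proof (rule sum.cong)
    fix m
    have "m - ?e = k \<longleftrightarrow> m = k + ?e" if "Poly_Mapping.lookup m i \<noteq> 0"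
      using shift[OF _ that] add_diff_cancel_right'[of k ?e] by blast
    then show "(of_nat (Poly_Mapping.lookup m i) * Poly_Mapping.lookup p m when m - ?e = k) =
        (of_nat (Poly_Mapping.lookup m i) * Poly_Mapping.lookup p m when m = k + ?e)"
      by (cases "Poly_Mapping.lookup m i = 0") (simp_all only: when_def of_nat_0 mult_zero_left if_cancel if_True not_False_eq_True simp_thms)
  qed simp
  also have "\<dots> = of_nat (Suc (Poly_Mapping.lookup k i)) * Poly_Mapping.lookup p (k + ?e)"
    unfolding when_def by (subst sum.delta) (simp_all add: in_keys_iff lookup_add)
  finally show ?thesis .
qed

lemma partial_deriv_commute:
  "partial_deriv i (partial_deriv j p) = partial_deriv j (partial_deriv i p)"
proof (cases "i = j")
  case False
  show ?thesis
  proof (rule poly_mapping_eqI)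
    fix k
    show "Poly_Mapping.lookup (partial_deriv i (partial_deriv j p)) k =
        Poly_Mapping.lookup (partial_deriv j (partial_deriv i p)) k"
      using False add.assoc[of k "Poly_Mapping.single i 1" "Poly_Mapping.single j 1"]
        add.assoc[of k "Poly_Mapping.single j 1" "Poly_Mapping.single i 1"]
        add.commute[of "Poly_Mapping.single i 1" "Poly_Mapping.single j (1::nat)"]
      by (simp add: lookup_partial_deriv lookup_add lookup_single_not_eq)
  qed
qed simp

lemma partial_deriv_add: "partial_deriv i (p + q) = partial_deriv i p + partial_deriv i q"
  by (rule poly_mapping_eqI) (simp add: lookup_partial_deriv lookup_add algebra_simps)

lemma partial_deriv_0 [simp]: "partial_deriv i 0 = 0"
  by (simp add: partial_deriv_def)

lemma partial_deriv_sum: "partial_deriv i (sum f A) = (\<Sum>a\<in>A. partial_deriv i (f a))"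
  by (induction A rule: infinite_finite_induct) (simp_all add: partial_deriv_add)

lemma partial_deriv_single:
  "partial_deriv i (Poly_Mapping.single m c) =
    Poly_Mapping.single (m - Poly_Mapping.single i 1) (of_nat (Poly_Mapping.lookup m i) * c)"
  by (cases "c = 0") (simp_all add: partial_deriv_def)

lemma homogeneous_partial_deriv:
  assumes "homogeneous d p"
  shows "homogeneous (d - 1) (partial_deriv i p)"
  unfolding homogeneous_def
proof
  fix k assume "k \<in> Poly_Mapping.keys (partial_deriv i p)"
  then have "k + Poly_Mapping.single i 1 \<in> Poly_Mapping.keys p"
    by (auto simp: in_keys_iff lookup_partial_deriv)
  then have *: "(\<Sum>j\<in>Poly_Mapping.keys (k + Poly_Mapping.single i 1).
      Poly_Mapping.lookup (k + Poly_Mapping.single i 1) j) = d"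
    using assms by (auto simp: homogeneous_def)
  let ?S = "insert i (Poly_Mapping.keys k)"
  have "(\<Sum>j\<in>Poly_Mapping.keys (k + Poly_Mapping.single i 1).
      Poly_Mapping.lookup (k + Poly_Mapping.single i 1) j) =
      (\<Sum>j\<in>?S. Poly_Mapping.lookup (k + Poly_Mapping.single i 1) j)"
    by (rule sum.mono_neutral_left)
       (auto simp: in_keys_iff lookup_add lookup_single when_def split: if_splits)
  also have "\<dots> = (\<Sum>j\<in>?S. Poly_Mapping.lookup k j) + 1"
    by (simp add: lookup_add sum.distrib lookup_single when_def sum.delta del: sum.insert)
  also have "(\<Sum>j\<in>?S. Poly_Mapping.lookup k j) = (\<Sum>j\<in>Poly_Mapping.keys k. Poly_Mapping.lookup k j)"
    by (rule sum.mono_neutral_right) (auto simp: in_keys_iff)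
  finally show "(\<Sum>j\<in>Poly_Mapping.keys k. Poly_Mapping.lookup k j) = d - 1"
    using * by simp
qed

section \<open>Polynomial functions and their derivatives along lines\<close>

lemma vars_eq_lookup: "j \<in> vars p \<longleftrightarrow> (\<exists>m\<in>Poly_Mapping.keys p. Poly_Mapping.lookup m j \<noteq> 0)"
  by (auto simp: vars_def in_keys_iff)

lemma finite_vars: "finite (vars p)"
  by (simp add: vars_def)

text \<open>The product rule. The set \<open>A\<close> may exceed the support of \<open>m\<close>,
  so that one finite index set serves all monomials of a polynomial, even over an infinite type of
  variables.\<close>

lemma has_field_derivative_monomial_line:
  fixes m :: "'v \<Rightarrow>\<^sub>0 nat"
  assumes "finite A" "Poly_Mapping.keys m \<subseteq> A"
  shows "((\<lambda>t. peval (Poly_Mapping.single m c) (\<lambda>i. x i + t * y i)) has_field_derivative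
    (\<Sum>i\<in>A. y i * peval (partial_deriv i (Poly_Mapping.single m c)) (\<lambda>i. x i + t * y i))) (at t)"
proof -
  have ev: "peval (Poly_Mapping.single k c) z = c * (\<Prod>i\<in>A. z i ^ Poly_Mapping.lookup k i)"
    if "Poly_Mapping.keys k \<subseteq> A" for k c and z :: "'v \<Rightarrow> complex"
    unfolding peval_single
    by (intro arg_cong2[where f="(*)"] refl prod.mono_neutral_left)
       (use assms(1) that in \<open>auto simp: in_keys_iff\<close>)
  have sub: "Poly_Mapping.keys (m - Poly_Mapping.single i 1) \<subseteq> A" for i
    using assms(2) by (auto simp: in_keys_iff lookup_minus)
  have "((\<lambda>t. c * (\<Prod>i\<in>A. (x i + t * y i) ^ Poly_Mapping.lookup m i)) has_field_derivative
     c * (\<Sum>i\<in>A. (of_nat (Poly_Mapping.lookup m i) * (y i * (x i + t * y i) ^ (Poly_Mapping.lookup m i - 1))) *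
       (\<Prod>j\<in>A - {i}. (x j + t * y j) ^ Poly_Mapping.lookup m j))) (at t)"
    by (intro DERIV_cmult has_field_derivative_prod) (auto intro!: derivative_eq_intros)
  moreover have "c * (\<Sum>i\<in>A. (of_nat (Poly_Mapping.lookup m i) * (y i * (x i + t * y i) ^ (Poly_Mapping.lookup m i - 1))) *
       (\<Prod>j\<in>A - {i}. (x j + t * y j) ^ Poly_Mapping.lookup m j)) =
     (\<Sum>i\<in>A. y i * peval (partial_deriv i (Poly_Mapping.single m c)) (\<lambda>i. x i + t * y i))"
    unfolding sum_distrib_left
  proof (rule sum.cong)
    fix i assume i: "i \<in> A"
    have "(\<Prod>j\<in>A. (x j + t * y j) ^ Poly_Mapping.lookup (m - Poly_Mapping.single i 1) j) =
        (x i + t * y i) ^ (Poly_Mapping.lookup m i - 1) *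
        (\<Prod>j\<in>A - {i}. (x j + t * y j) ^ Poly_Mapping.lookup m j)"
      using assms(1) i
      by (subst prod.remove[of A i]) (auto simp: lookup_minus lookup_single when_def intro!: prod.cong)
    then show "c * ((of_nat (Poly_Mapping.lookup m i) * (y i * (x i + t * y i) ^ (Poly_Mapping.lookup m i - 1))) *
       (\<Prod>j\<in>A - {i}. (x j + t * y j) ^ Poly_Mapping.lookup m j)) =
       y i * peval (partial_deriv i (Poly_Mapping.single m c)) (\<lambda>i. x i + t * y i)"
      unfolding partial_deriv_single ev[OF sub] by (simp add: mult_ac)
  qed simp
  ultimately show ?thesis
    unfolding ev[OF assms(2)] by simp
qed

lemma has_field_derivative_peval_line:
  fixes p :: "'v cpoly"
  assumes "finite A" "vars p \<subseteq> A"
  shows "((\<lambda>t. peval p (\<lambda>i. x i + t * y i)) has_field_derivative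
    (\<Sum>i\<in>A. y i * peval (partial_deriv i p) (\<lambda>i. x i + t * y i))) (at t)"
proof -
  let ?s = "\<lambda>m. Poly_Mapping.single m (Poly_Mapping.lookup p m)"
  have "((\<lambda>t. \<Sum>m\<in>Poly_Mapping.keys p. peval (?s m) (\<lambda>i. x i + t * y i)) has_field_derivative
    (\<Sum>m\<in>Poly_Mapping.keys p. \<Sum>i\<in>A. y i * peval (partial_deriv i (?s m)) (\<lambda>i. x i + t * y i))) (at t)"
    by (intro DERIV_sum has_field_derivative_monomial_line) (use assms in \<open>auto simp: vars_def\<close>)
  moreover have "peval p = (\<lambda>z. \<Sum>m\<in>Poly_Mapping.keys p. peval (?s m) z)"
    by (subst cpoly_eq_sum_single[of p]) (simp add: peval_sum fun_eq_iff)
  moreover have "partial_deriv i p = (\<Sum>m\<in>Poly_Mapping.keys p. partial_deriv i (?s m))" for i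
    by (subst cpoly_eq_sum_single[of p]) (simp add: partial_deriv_sum)
  moreover have "(\<Sum>m\<in>Poly_Mapping.keys p. \<Sum>i\<in>A. y i * peval (partial_deriv i (?s m)) (\<lambda>i. x i + t * y i)) =
     (\<Sum>i\<in>A. y i * (\<Sum>m\<in>Poly_Mapping.keys p. peval (partial_deriv i (?s m)) (\<lambda>i. x i + t * y i)))"
    by (subst sum.swap) (simp add: sum_distrib_left)
  ultimately show ?thesis by (simp only: peval_sum)
qed

text \<open>Along the \<open>j\<close>-th axis the function is constant, and its derivative there is
  the value of the formal partial derivative.\<close>

lemma peval_partial_deriv_eq_0:
  assumes "\<And>x c. peval p (x(j := c)) = peval p x"
  shows "peval (partial_deriv j p) x = 0"
proof -
  let ?y = "\<lambda>i. if i = j then 1 else (0::complex)"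
  have "x(j := x j + t) = (\<lambda>i. x i + t * ?y i)" for t by auto
  then have "peval p (\<lambda>i. x i + t * ?y i) = peval p x" for t
    using assms[of x "x j + t"] by simp
  moreover have "((\<lambda>t. peval p (\<lambda>i. x i + t * ?y i)) has_field_derivative
    (\<Sum>i\<in>insert j (vars p). ?y i * peval (partial_deriv i p) (\<lambda>i. x i + 0 * ?y i))) (at 0)"
    by (rule has_field_derivative_peval_line) (auto simp: finite_vars)
  moreover have "(\<Sum>i\<in>insert j (vars p). ?y i * peval (partial_deriv i p) (\<lambda>i. x i + 0 * ?y i)) =
     (\<Sum>i\<in>insert j (vars p). if i = j then peval (partial_deriv i p) x else 0)"
    by (intro sum.cong) auto
  moreover have "\<dots> = peval (partial_deriv j p) x"
    by (subst sum.delta) (auto simp: finite_vars)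
  ultimately have "((\<lambda>t::complex. peval p x) has_field_derivative peval (partial_deriv j p) x) (at 0)"
    by simp
  then show ?thesis
    using DERIV_const DERIV_unique by blast
qed

text \<open>Induction on the degree of the exponent \<open>m\<close>. Partial derivatives of a
  polynomial that vanishes everywhere vanish everywhere too, and in characteristic zero the
  coefficient at \<open>m\<close> can be read off from one of lower degree in
  \<open>partial_deriv i p\<close>. Degree 0 is the value at the origin.\<close>

lemma cpoly_eq_0_if_peval_eq_0:
  fixes p :: "'v cpoly"
  assumes "\<And>x. peval p x = 0"
  shows "p = 0"
proof -
  have "Poly_Mapping.lookup p m = 0"
    if "\<And>x. peval p x = 0" "(\<Sum>i\<in>Poly_Mapping.keys m. Poly_Mapping.lookup m i) = n"
    for n and p :: "'v cpoly" and m
    using that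
  proof (induction n arbitrary: p m)
    case 0
    then have "m = 0"
      by (intro poly_mapping_eqI) (auto simp: in_keys_iff)
    have pw: "c * (\<Prod>i\<in>Poly_Mapping.keys k. 0 ^ Poly_Mapping.lookup k i) = (if k = 0 then c else (0::complex))"
      for c and k :: "'v \<Rightarrow>\<^sub>0 nat"
    proof (cases "k = 0")
      case False
      then obtain i where "i \<in> Poly_Mapping.keys k" by fastforce
      then show ?thesis using False
        by (auto simp: in_keys_iff intro!: prod_zero bexI[of _ i])
    qed simp
    then have "peval p (\<lambda>_. 0) = (\<Sum>k\<in>Poly_Mapping.keys p. if k = 0 then Poly_Mapping.lookup p k else 0)"
      unfolding peval_def by (simp only: pw)
    also have "\<dots> = Poly_Mapping.lookup p 0"
      by (auto simp: sum.delta in_keys_iff)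
    finally show ?case using 0 \<open>m = 0\<close> by simp
  next
    case (Suc n)
    then obtain i where i: "i \<in> Poly_Mapping.keys m"
      by (metis equals0I sum.empty nat.distinct(1))
    let ?k = "m - Poly_Mapping.single i 1"
    have m: "m = ?k + Poly_Mapping.single i 1"
      using i by (intro poly_mapping_eqI) (auto simp: in_keys_iff lookup_add lookup_minus lookup_single when_def)
    have "(\<Sum>j\<in>Poly_Mapping.keys m. Poly_Mapping.lookup m j) =
       (\<Sum>j\<in>Poly_Mapping.keys m. Poly_Mapping.lookup ?k j + (if j = i then 1 else 0))"
      using i by (intro sum.cong) (auto simp: in_keys_iff lookup_minus lookup_single when_def)
    also have "\<dots> = (\<Sum>j\<in>Poly_Mapping.keys m. Poly_Mapping.lookup ?k j) + 1"
      using i by (simp add: sum.distrib)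
    also have "(\<Sum>j\<in>Poly_Mapping.keys m. Poly_Mapping.lookup ?k j) =
        (\<Sum>j\<in>Poly_Mapping.keys ?k. Poly_Mapping.lookup ?k j)"
      by (rule sum.mono_neutral_right) (auto simp: in_keys_iff lookup_minus)
    finally have deg: "(\<Sum>j\<in>Poly_Mapping.keys ?k. Poly_Mapping.lookup ?k j) = n"
      using Suc.prems by simp
    have "Poly_Mapping.lookup (partial_deriv i p) ?k = 0"
      by (rule Suc.IH[OF _ deg]) (rule peval_partial_deriv_eq_0, simp add: Suc.prems)
    then show ?case unfolding lookup_partial_deriv m[symmetric] by (simp add: of_nat_neq_0 del: of_nat_Suc)
  qed
  then show ?thesis using assms by (intro poly_mapping_eqI) auto
qed

section \<open>Evaluation, homogeneity and substitution\<close>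

lemma const_0 [simp]: "const 0 = 0" by (simp add: const_def)
lemma const_1 [simp]: "const 1 = 1" by (simp add: const_def)
lemma const_add: "const (a + b) = const a + const b" by (simp add: const_def single_add)
lemma const_mult: "const (a * b) = const a * const b" by (simp add: const_def mult_single)

lemma peval_const [simp]: "peval (const c) x = c"
  by (simp add: const_def peval_single)

lemma peval_1 [simp]: "peval 1 x = 1"
  using peval_const[of 1] by simp

lemma peval_Var [simp]: "peval (Var i) x = x i"
  by (simp add: Var_def peval_single)

lemma peval_minus: "peval (p - q) x = peval p x - peval q x"
  using peval_add[of "p - q" q x] by simp

lemma peval_prod: "peval (prod f A) x = (\<Prod>a\<in>A. peval (f a) x)"
  by (induction A rule: infinite_finite_induct) (simp_all add: peval_mult)

lemma peval_power: "peval (p ^ n) x = peval p x ^ n"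
  by (induction n) (simp_all add: peval_mult)

lemma cpoly_eqI:
  assumes "\<And>x. peval p x = peval q x"
  shows "p = q"
  using cpoly_eq_0_if_peval_eq_0[of "p - q"] assms by (simp add: peval_minus)

text \<open>The derivative by \<open>j\<close> vanishes as a function, hence as a polynomial, which
  leaves no monomial containing \<open>j\<close>. This turns translation invariance of a form into a
  bound on its \<open>vars\<close>.\<close>

lemma not_in_vars:
  assumes "\<And>x c. peval p (x(j := c)) = peval p x"
  shows "j \<notin> vars p"
proof
  assume "j \<in> vars p"
  then obtain m where m: "m \<in> Poly_Mapping.keys p" "Poly_Mapping.lookup m j \<noteq> 0"
    by (auto simp: vars_eq_lookup)
  have "partial_deriv j p = 0"
    by (rule cpoly_eq_0_if_peval_eq_0) (rule peval_partial_deriv_eq_0[OF assms])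
  moreover have "m = (m - Poly_Mapping.single j 1) + Poly_Mapping.single j 1"
    using m(2) by (intro poly_mapping_eqI) (auto simp: lookup_add lookup_minus lookup_single when_def)
  ultimately show False
    using lookup_partial_deriv[of j p "m - Poly_Mapping.single j 1"] m(1)
    by (simp add: in_keys_iff of_nat_neq_0 del: of_nat_Suc)
qed

lemma peval_cong_vars:
  assumes "\<And>i. i \<in> vars p \<Longrightarrow> x i = y i"
  shows "peval p x = peval p y"
proof -
  have "x i = y i" if "m \<in> Poly_Mapping.keys p" "i \<in> Poly_Mapping.keys m" for m i
    by (rule assms) (use that in \<open>auto simp: vars_def\<close>)
  then show ?thesis by (simp add: peval_def)
qed

lemma peval_psubst: "peval (psubst p g) x = peval p (\<lambda>i. peval (g i) x)"
  by (simp add: psubst_def peval_sum peval_mult peval_prod peval_power) (simp add: peval_def)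

lemma homogeneous_const [simp]: "homogeneous 0 (const c)"
  by (simp add: homogeneous_def const_def)

lemma homogeneous_1 [simp]: "homogeneous 0 1"
  using homogeneous_const[of 1] by simp

lemma homogeneous_0 [simp]: "homogeneous d 0"
  by (simp add: homogeneous_def)

lemma homogeneous_Var [simp]: "homogeneous (Suc 0) (Var i)"
  by (simp add: homogeneous_def Var_def)

lemma homogeneous_add: "homogeneous d p \<Longrightarrow> homogeneous d q \<Longrightarrow> homogeneous d (p + q)"
  using Poly_Mapping.keys_add[of p q] unfolding homogeneous_def by blast

lemma homogeneous_sum: "(\<And>a. a \<in> A \<Longrightarrow> homogeneous d (f a)) \<Longrightarrow> homogeneous d (sum f A)"
  by (induction A rule: infinite_finite_induct) (auto intro: homogeneous_add)

lemma homogeneous_const_mult: "homogeneous d p \<Longrightarrow> homogeneous d (const c * p)"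
  using homogeneous_mult[of 0 "const c" d p] by simp

lemma homogeneous_power: "homogeneous d p \<Longrightarrow> homogeneous (n * d) (p ^ n)"
  by (induction n) (auto intro: homogeneous_mult)

lemma homogeneous_prod:
  "(\<And>a. a \<in> A \<Longrightarrow> homogeneous (h a) (f a)) \<Longrightarrow> homogeneous (sum h A) (prod f A)"
  by (induction A rule: infinite_finite_induct) (auto intro: homogeneous_mult)

lemma homogeneous_psubst:
  assumes "homogeneous d p" "\<And>i. homogeneous e (g i)"
  shows "homogeneous (d * e) (psubst p g)"
  unfolding psubst_def
proof (intro homogeneous_sum homogeneous_const_mult)
  fix m assume "m \<in> Poly_Mapping.keys p"
  then have "d * e = (\<Sum>i\<in>Poly_Mapping.keys m. Poly_Mapping.lookup m i * e)"
    using assms(1) by (auto simp: homogeneous_def sum_distrib_right)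
  then show "homogeneous (d * e) (\<Prod>i\<in>Poly_Mapping.keys m. g i ^ Poly_Mapping.lookup m i)"
    by (auto intro!: homogeneous_prod homogeneous_power assms(2))
qed

text \<open>Sums, products and powers respect congruence modulo \<open>l\<close>. Serves to extract
  a linear factor from a form.\<close>

lemma dvd_psubst_diff:
  assumes "\<And>i. l dvd g i - h i"
  shows "l dvd psubst p g - psubst p h"
proof -
  have pow: "l dvd a ^ n - b ^ n" if "l dvd a - b" for a b :: "'b cpoly" and n
  proof (induction n)
    case (Suc n)
    have "a ^ Suc n - b ^ Suc n = a * (a ^ n - b ^ n) + (a - b) * b ^ n"
      by (simp add: algebra_simps)
    then show ?case using Suc that by (metis dvd_add dvd_mult dvd_mult2)
  qed simp
  have prod: "l dvd prod f A - prod f' A" if "\<And>i. i \<in> A \<Longrightarrow> l dvd f i - f' i"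
    for f f' :: "'a \<Rightarrow> 'b cpoly" and A
    using that
  proof (induction A rule: infinite_finite_induct)
    case (insert a A)
    have "prod f (insert a A) - prod f' (insert a A) =
        f a * (prod f A - prod f' A) + (f a - f' a) * prod f' A"
      using insert.hyps by (simp add: algebra_simps)
    then show ?case using insert by (metis dvd_add dvd_mult dvd_mult2 insertCI)
  qed auto
  show ?thesis
    unfolding psubst_def sum_subtractf[symmetric] right_diff_distrib[symmetric]
    by (intro dvd_sum dvd_mult prod pow assms)
qed

section \<open>Differentials and vertex spaces\<close>

definition dotp :: "complex ^ 'n::finite \<Rightarrow> complex ^ 'n \<Rightarrow> complex" where
  "dotp a v = (\<Sum>i\<in>UNIV. a $ i * v $ i)"

definition kerd :: "complex ^ 'n::finite \<Rightarrow> (complex ^ 'n) set" where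
  "kerd a = {z. dotp a z = 0}"

abbreviation ev :: "'n::finite cpoly \<Rightarrow> complex ^ 'n \<Rightarrow> complex" where
  "ev F v \<equiv> peval F (($) v)"

definition grad :: "'n::finite cpoly \<Rightarrow> complex ^ 'n \<Rightarrow> complex ^ 'n" where
  "grad F v = (\<chi> i. ev (partial_deriv i F) v)"

definition linform :: "complex ^ 'n::finite \<Rightarrow> 'n cpoly" where
  "linform a = (\<Sum>j\<in>UNIV. const (a $ j) * Var j)"

lemma ev_linform: "ev (linform a) v = dotp a v"
  by (simp add: linform_def dotp_def peval_sum peval_mult)

lemma homogeneous_linform: "homogeneous (Suc 0) (linform a)"
  unfolding linform_def by (intro homogeneous_sum homogeneous_const_mult homogeneous_Var)

lemma dotp_simps:
  "dotp a (v + w) = dotp a v + dotp a w" "dotp a (v - w) = dotp a v - dotp a w"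
  "dotp a (c *s v) = c * dotp a v" "dotp (a + b) v = dotp a v + dotp b v"
  "dotp (a - b) v = dotp a v - dotp b v" "dotp (c *s a) v = c * dotp a v"
  "dotp a 0 = 0" "dotp 0 v = 0"
  by (simp_all add: dotp_def algebra_simps sum.distrib sum_subtractf sum_distrib_left)

lemma dotp_axis: "dotp a (axis i c) = a $ i * c"
proof -
  have "dotp a (axis i c) = (\<Sum>j\<in>UNIV. if j = i then a $ j * c else 0)"
    unfolding dotp_def by (intro sum.cong) (auto simp: axis_def)
  then show ?thesis by simp
qed

lemma dotp_surj:
  assumes "a \<noteq> 0"
  obtains u where "dotp a u = 1"
proof -
  from assms obtain i where "a $ i \<noteq> 0" by (auto simp: vec_eq_iff)
  then have "dotp a (axis i (1 / a $ i)) = 1" by (simp add: dotp_axis)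
  then show ?thesis by (rule that)
qed

lemma subspace_kerd: "vec.subspace (kerd a)"
  by (auto simp: kerd_def vec.subspace_def dotp_simps)

text \<open>A vector \<open>u\<close> with \<open>dotp a u = 1\<close> spans a complement of the
  kernel.\<close>

lemma dim_kerd:
  fixes a :: "complex ^ 'n::finite"
  assumes "a \<noteq> 0"
  shows "vec.dim (kerd a) + 1 = CARD('n)"
proof -
  obtain u where u: "dotp a u = 1" using assms dotp_surj by blast
  have span: "vec.span (kerd a) = kerd a"
    using subspace_kerd vec.span_eq_iff by blast
  have "z \<in> vec.span (insert u (kerd a))" for z
  proof -
    have "z - dotp a z *s u \<in> kerd a" using u by (simp add: kerd_def dotp_simps)
    then show ?thesis unfolding vec.span_insert span by blast
  qed
  then have "vec.span (insert u (kerd a)) = UNIV" by blast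
  then have "vec.dim (insert u (kerd a)) = vec.dim (UNIV :: (complex ^ 'n) set)"
    by (metis vec.dim_span)
  moreover have "u \<notin> vec.span (kerd a)" unfolding span using u by (simp add: kerd_def)
  ultimately show ?thesis by (simp add: vec.dim_insert vec_dim_card del: vec.dim_UNIV)
qed

lemma kerd_eqI:
  assumes "a \<noteq> 0" "b \<noteq> 0" "kerd a \<subseteq> kerd b"
  shows "kerd b = kerd a"
  using assms dim_kerd[of a] dim_kerd[of b] subspace_kerd
    vec.subspace_dim_equal[OF subspace_kerd subspace_kerd assms(3)] by simp

section \<open>Behaviour along lines and under scaling\<close>

lemma ev_line_eq: "ev p (v + t *s w) = peval p (\<lambda>i. v $ i + t * w $ i)"
  by (rule arg_cong[where f="peval p"]) (simp add: fun_eq_iff)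

lemma ev_line_deriv:
  "((\<lambda>t. ev p (v + t *s w)) has_field_derivative dotp (grad p (v + t *s w)) w) (at t)"
  using has_field_derivative_peval_line[of UNIV p "($) v" "($) w" t]
  by (simp only: ev_line_eq grad_def dotp_def) (simp add: mult.commute)

lemma ev_scale: "homogeneous d p \<Longrightarrow> ev p (c *s v) = c ^ d * ev p v"
proof -
  have "($) (c *s v) = (\<lambda>i. c * v $ i)" by (simp add: fun_eq_iff)
  then show "homogeneous d p \<Longrightarrow> ev p (c *s v) = c ^ d * ev p v"
    by (simp only: peval_scale)
qed

lemma grad_scale: "homogeneous d p \<Longrightarrow> grad p (c *s v) = c ^ (d - 1) *s grad p v"
  using ev_scale[OF homogeneous_partial_deriv, of d p] by (simp add: grad_def vec_eq_iff)

lemma ev_0: "homogeneous d p \<Longrightarrow> d > 0 \<Longrightarrow> ev p 0 = 0"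
  using ev_scale[of d p 0 0] by (simp add: power_0_left)

text \<open>Euler's identity, from differentiating \<open>p(t v) = t^d p(v)\<close> at
  \<open>t = 1\<close> in two ways.\<close>

lemma grad_dotp_self:
  assumes "homogeneous d p"
  shows "dotp (grad p v) v = of_nat d * ev p v"
proof -
  have "((\<lambda>t. ev p (0 + t *s v)) has_field_derivative dotp (grad p (0 + 1 *s v)) v) (at 1)"
    by (rule ev_line_deriv)
  then have "((\<lambda>t. t ^ d * ev p v) has_field_derivative dotp (grad p v) v) (at 1)"
    by (simp add: ev_scale[OF assms])
  moreover have "((\<lambda>t::complex. t ^ d * ev p v) has_field_derivative of_nat d * ev p v) (at 1)"
    by (auto intro!: derivative_eq_intros)
  ultimately show ?thesis using DERIV_unique by blast
qed

lemma tendsto_ev [tendsto_intros]: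
  assumes "(f \<longlongrightarrow> v) G"
  shows "((\<lambda>x. ev p (f x)) \<longlongrightarrow> ev p v) G"
  unfolding peval_def by (intro tendsto_intros assms)

lemma tendsto_grad [tendsto_intros]:
  assumes "(f \<longlongrightarrow> v) G"
  shows "((\<lambda>x. grad p (f x)) \<longlongrightarrow> grad p v) G"
  unfolding grad_def by (intro vec_tendstoI) (simp add: tendsto_intros assms)

lemma tendsto_dotp [tendsto_intros]:
  assumes "(f \<longlongrightarrow> a) G" "(g \<longlongrightarrow> b) G"
  shows "((\<lambda>x. dotp (f x) (g x)) \<longlongrightarrow> dotp a b) G"
  unfolding dotp_def by (intro tendsto_intros assms)

text \<open>Built monomial by monomial from the linear polynomials \<open>v $ i + t * w $ i\<close>.
  Reduces questions in several variables to univariate polynomials.\<close>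

lemma ev_line_poly: "\<exists>q. \<forall>t. poly q t = ev p (v + t *s w)"
proof -
  define q where "q = (\<Sum>m\<in>Poly_Mapping.keys p. [:Poly_Mapping.lookup p m:] *
     (\<Prod>i\<in>Poly_Mapping.keys m. [:v $ i, w $ i:] ^ Poly_Mapping.lookup m i))"
  have "poly q t = ev p (v + t *s w)" for t
    unfolding q_def peval_def by (simp add: poly_sum poly_prod poly_power)
  then show ?thesis by blast
qed

text \<open>Linear spaces are irreducible: if neither factor vanished on \<open>W\<close>, the line
  through two witnesses would carry two nonzero univariate polynomials with product zero.\<close>

lemma ev_product_zero_on_subspace:
  assumes W: "vec.subspace W" and fg: "\<And>w. w \<in> W \<Longrightarrow> ev f w * ev g w = 0"
  shows "(\<forall>w\<in>W. ev f w = 0) \<or> (\<forall>w\<in>W. ev g w = 0)"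
proof (rule ccontr)
  assume "\<not> ?thesis"
  then obtain x y where xy: "x \<in> W" "y \<in> W" "ev f x \<noteq> 0" "ev g y \<noteq> 0" by blast
  obtain q r where q: "\<forall>t. poly q t = ev f (x + t *s (y - x))"
    and r: "\<forall>t. poly r t = ev g (x + t *s (y - x))"
    using ev_line_poly[of f x "y - x"] ev_line_poly[of g x "y - x"] by blast
  have "poly (q * r) t = 0" for t
    using q r fg xy W
    by (auto simp: vec.subspace_add vec.subspace_scale vec.subspace_diff)
  then have "q * r = 0" using poly_all_0_iff_0 by blast
  moreover have "poly q 0 \<noteq> 0" "poly r 1 \<noteq> 0" using q r xy by auto
  ultimately show False by auto
qed

text \<open>A form vanishing on \<open>kerd a\<close> would be divisible by the linear form of
  \<open>a\<close>. Irreducibility makes the cofactor a unit, which is incompatible with degree at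
  least 2.\<close>

lemma irreducible_not_zero_on_hyperplane:
  fixes F :: "'n::finite cpoly"
  assumes hom: "homogeneous d F" and "d \<ge> 2" and irr: "irreducible F" and "a \<noteq> 0"
  obtains z where "z \<in> kerd a" "ev F z \<noteq> 0"
proof (rule ccontr)
  assume "\<not> thesis"
  then have van: "ev F z = 0" if "dotp a z = 0" for z
    using that \<open>\<And>z. z \<in> kerd a \<Longrightarrow> ev F z \<noteq> 0 \<Longrightarrow> thesis\<close> by (auto simp: kerd_def)
  from \<open>a \<noteq> 0\<close> obtain i where i: "a $ i \<noteq> 0" by (auto simp: vec_eq_iff)
  define l where "l = linform a"
  have l: "peval l x = dotp a (\<chi> j. x j)" for x
    by (simp add: l_def linform_def peval_sum peval_mult dotp_def)
  \<comment> \<open>Substituting \<open>g\<close> projects along the \<open>i\<close>-th axis onto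
    \<open>kerd a\<close>: it changes nothing modulo \<open>l\<close>, yet turns \<open>F\<close>
    into 0.\<close>
  define g where "g = Var(i := Var i - const (1 / a $ i) * l)"
  have "l dvd Var j - g j" for j
    by (simp add: g_def)
  then have "l dvd psubst F Var - psubst F g" by (rule dvd_psubst_diff)
  moreover have "psubst F Var = F" by (rule cpoly_eqI) (simp add: peval_psubst)
  moreover have "psubst F g = 0"
  proof (rule cpoly_eq_0_if_peval_eq_0)
    fix x :: "'n \<Rightarrow> complex"
    define v where "v = (\<chi> j. x j)"
    have "(\<lambda>j. peval (g j) x) = ($) (v - (dotp a v / a $ i) *s axis i 1)"
      by (auto simp: g_def fun_eq_iff v_def peval_minus peval_mult l axis_def)
    moreover have "dotp a (v - (dotp a v / a $ i) *s axis i 1) = 0"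
      using i by (simp add: dotp_simps dotp_axis)
    ultimately show "peval (psubst F g) x = 0" using van by (simp add: peval_psubst)
  qed
  ultimately obtain Q where Q: "F = l * Q" by (auto elim: dvdE)
  from irr Q have "l dvd 1 \<or> Q dvd 1" by (simp add: irreducible_def)
  then show False
  proof
    assume "l dvd 1"
    then obtain r where "1 = l * r" by (auto elim: dvdE)
    then have "1 = peval l (($) 0) * peval r (($) 0)" by (metis peval_1 peval_mult)
    moreover have "peval l (($) 0) = 0" unfolding l by (simp add: dotp_def)
    ultimately show False by simp
  next
    assume "Q dvd 1"
    then obtain R where QR: "1 = Q * R" by (auto elim: dvdE)
    \<comment> \<open>On the line spanned by \<open>u\<close> the unit \<open>Q\<close> becomes a
      unit among the univariate polynomials, hence a constant \<open>c\<close>. Comparing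
      \<open>F\<close> at \<open>u\<close> and at \<open>2 u\<close> gives
      \<open>2 = 2 ^ d\<close>.\<close>
    obtain u where u: "dotp a u = 1" using \<open>a \<noteq> 0\<close> dotp_surj by blast
    obtain q r where q: "\<forall>t. poly q t = ev Q (0 + t *s u)" and r: "\<forall>t. poly r t = ev R (0 + t *s u)"
      using ev_line_poly[of Q 0 u] ev_line_poly[of R 0 u] by blast
    have "poly (q * r) t = poly 1 t" for t
      using q r QR by (metis peval_1 peval_mult poly_1 poly_mult)
    then have "q * r = 1" by (simp add: poly_eq_poly_eq_iff[symmetric] fun_eq_iff)
    then have "q dvd 1" by (metis dvd_triv_left)
    then obtain c where c: "q = [:c:]" "c \<noteq> 0"
      by (metis dvd_0_left_iff is_unit_poly_iff zero_neq_one)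
    have "ev Q (1 *s u) = c" "ev Q (2 *s u) = c" using spec[OF q, of 1] spec[OF q, of 2] c
      by simp_all
    moreover have "ev F (2 *s u) = 2 ^ d * ev F (1 *s u)" using ev_scale[OF hom] by simp
    moreover have "ev l (1 *s u) = 1" "ev l (2 *s u) = 2"
      using u unfolding l by (simp_all add: dotp_simps)
    ultimately have "2 * c = 2 ^ d * (1 * c)" by (simp only: Q peval_mult)
    then have "(2::complex) ^ 1 = 2 ^ d" using c(2) by simp
    then have "(2::nat) ^ 1 = 2 ^ d" by (metis of_nat_eq_iff of_nat_numeral of_nat_power)
    then show False using \<open>d \<ge> 2\<close> power_inject_exp[of "2::nat" 1 d] by simp
  qed
qed

text \<open>The vectors of \<open>K\<close> along which \<open>F\<close> restricted to \<open>K\<close> is invariant, see \<open>vtx_translate\<close>.\<close>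

definition vtx :: "'n::finite cpoly \<Rightarrow> (complex ^ 'n) set \<Rightarrow> (complex ^ 'n) set" where
  "vtx F K = {w \<in> K. \<forall>z\<in>K. dotp (grad F z) w = 0}"

lemma subspace_vtx:
  assumes "vec.subspace K"
  shows "vec.subspace (vtx F K)"
  using assms by (auto simp: vtx_def vec.subspace_def dotp_simps)

text \<open>The derivative of \<open>F\<close> along \<open>w\<close> vanishes at every point of the
  line \<open>z + t w\<close>, because this line stays in \<open>K\<close>.\<close>

lemma vtx_translate:
  assumes K: "vec.subspace K" and "w \<in> vtx F K" "z \<in> K"
  shows "ev F (z + w) = ev F z"
proof -
  have w: "w \<in> K" "dotp (grad F (z + t *s w)) w = 0" for t
    using assms by (auto simp: vtx_def vec.subspace_add vec.subspace_scale)
  have "((\<lambda>t. ev F (z + t *s w)) has_field_derivative 0) (at t within UNIV)" for t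
    using ev_line_deriv[of F z w t] w(2)[of t] by simp
  then obtain c where c: "\<And>t. ev F (z + t *s w) = c"
    using has_field_derivative_zero_constant[of UNIV "\<lambda>t. ev F (z + t *s w)"] by auto
  show ?thesis using c[of 1] c[of 0] by simp
qed

lemma vtxI:
  assumes "w \<in> K" "\<And>z t. z \<in> K \<Longrightarrow> ev F (z + t *s w) = ev F z"
  shows "w \<in> vtx F K"
proof -
  have "dotp (grad F z) w = 0" if "z \<in> K" for z
  proof -
    have "((\<lambda>t::complex. ev F z) has_field_derivative dotp (grad F z) w) (at 0)"
      using ev_line_deriv[of F z w 0] assms(2)[OF that] by simp
    from DERIV_unique[OF this DERIV_const] show ?thesis .
  qed
  then show ?thesis using assms(1) by (simp add: vtx_def)
qed

lemma vtx_zero: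
  assumes "vec.subspace K" "w \<in> vtx F K" "homogeneous d F" "d > 0"
  shows "ev F w = 0"
  using vtx_translate[OF assms(1,2), of 0] assms ev_0 by (simp add: vec.subspace_0)

text \<open>Invariance and homogeneity give \<open>F(w + s z) = s^d F(z)\<close>, whose derivative
  at \<open>s = 0\<close> is 0.\<close>

lemma grad_vtx:
  assumes K: "vec.subspace K" and w: "w \<in> vtx F K" and "z \<in> K" and hom: "homogeneous d F" and "d \<ge> 2"
  shows "dotp (grad F w) z = 0"
proof -
  have "ev F (w + s *s z) = s ^ d * ev F z" for s
    using vtx_translate[OF K w, of "s *s z"] K \<open>z \<in> K\<close> ev_scale[OF hom]
    by (simp add: add.commute vec.subspace_scale)
  then have "((\<lambda>s. s ^ d * ev F z) has_field_derivative dotp (grad F w) z) (at 0)"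
    using ev_line_deriv[of F w z 0] by simp
  moreover have "((\<lambda>s::complex. s ^ d * ev F z) has_field_derivative 0) (at 0)"
    using \<open>d \<ge> 2\<close> by (auto intro!: derivative_eq_intros)
  ultimately show ?thesis using DERIV_unique by blast
qed

text \<open>The form that \<open>star_point\<close> takes on representatives, see
  \<open>star_point_span\<close>. For forms of positive degree, the vertex condition contains that
  \<open>v\<close> lies on the hypersurface, by \<open>vtx_zero\<close>.\<close>

definition is_star :: "'n::finite cpoly \<Rightarrow> complex ^ 'n \<Rightarrow> bool" where
  "is_star F v \<longleftrightarrow> grad F v \<noteq> 0 \<and> v \<in> vtx F (kerd (grad F v))"

text \<open>\<open>grad_vtx\<close> gives one inclusion of the kernels, and of two hyperplanes one
  inside the other both coincide. Thus all smooth vectors of a vertex space share one tangent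
  hyperplane.\<close>

lemma vtx_star:
  assumes hom: "homogeneous d F" and "d \<ge> 2" and "a \<noteq> 0" and w: "w \<in> vtx F (kerd a)" "grad F w \<noteq> 0"
  shows "kerd (grad F w) = kerd a" "is_star F w"
proof -
  have "kerd a \<subseteq> kerd (grad F w)"
    using grad_vtx[OF subspace_kerd w(1) _ hom \<open>d \<ge> 2\<close>] by (auto simp: kerd_def)
  then show *: "kerd (grad F w) = kerd a"
    using \<open>a \<noteq> 0\<close> w(2) by (intro kerd_eqI)
  show "is_star F w" using w by (simp add: is_star_def *)
qed

section \<open>Cones and star points in coordinates\<close>

lemma span_singleton_subset_iff:
  "vec.subspace U \<Longrightarrow> vec.span {v} \<subseteq> U \<longleftrightarrow> v \<in> U"
  by (meson empty_subsetI insert_subset subset_trans vec.span_minimal vec.span_superset)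

lemma proj_space_nonzero:
  assumes "L \<in> proj_space" "v \<in> L" "v \<noteq> 0"
  shows "L = vec.span {v}"
proof -
  obtain u where u: "u \<noteq> 0" "L = vec.span {u}" using assms(1) by (auto simp: proj_space_eq_span)
  then obtain c where c: "v = c *s u" using assms(2) by (auto simp: vec.span_singleton)
  with assms(3) have "u = (1 / c) *s v" by auto
  then have "u \<in> vec.span {v}" by (metis vec.span_base vec.span_scale singletonI)
  then show ?thesis
    using assms(2) unfolding u(2)
    by (intro subset_antisym) (simp_all add: span_singleton_subset_iff)
qed

lemma span_singleton_in_proj_space: "v \<noteq> 0 \<Longrightarrow> vec.span {v} \<in> proj_space"
  by (auto simp: proj_space_eq_span)

text \<open>Each nonzero vector spans a line, so a subspace is determined by the lines in it. Used
  to pass from hyperplanes as sets of points to vector spaces.\<close>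

lemma subspace_eqI_lines:
  assumes "vec.subspace U" "vec.subspace V"
    "{L \<in> proj_space. L \<subseteq> U} = {L \<in> proj_space. L \<subseteq> V}"
  shows "U = V"
proof -
  have "v \<in> V" if "v \<in> U" "vec.subspace U" "vec.subspace V"
    "{L \<in> proj_space. L \<subseteq> U} \<subseteq> {L \<in> proj_space. L \<subseteq> V}" for v and U V :: "(complex ^ 'a) set"
  proof (cases "v = 0")
    case False
    then have "vec.span {v} \<in> {L \<in> proj_space. L \<subseteq> U}"
      using that by (simp add: span_singleton_in_proj_space span_singleton_subset_iff)
    then show ?thesis using that span_singleton_subset_iff by blast
  qed (use that in \<open>simp add: vec.subspace_0\<close>)
  then show ?thesis using assms by blast
qed

lemma peval_restrict_form:
  fixes F :: "'n::finite cpoly"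
  shows "peval (restrict_form F b) y = ev F (\<Sum>j<CARD('n) - 1. y j *s b j)"
proof -
  have "(\<lambda>i. \<Sum>j<CARD('n) - 1. b j $ i * y j) = ($) (\<Sum>j<CARD('n) - 1. y j *s b j)"
    by (simp add: fun_eq_iff mult.commute)
  then show ?thesis
    by (simp add: restrict_form_def peval_psubst peval_sum peval_mult)
qed

lemma homogeneous_restrict_form:
  "homogeneous d F \<Longrightarrow> homogeneous d (restrict_form F b)"
  using homogeneous_psubst[of d F 1 "\<lambda>i. \<Sum>j<CARD('a) - 1. const (b j $ i) * Var j"]
  by (simp add: restrict_form_def homogeneous_sum homogeneous_const_mult)

lemma in_span_image_lessThan:
  fixes b :: "nat \<Rightarrow> complex ^ 'n::finite"
  assumes "inj_on b {..<m}" "z \<in> vec.span (b ` {..<m})"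
  obtains y where "z = (\<Sum>j<m. y j *s b j)"
proof -
  obtain u where "z = (\<Sum>v\<in>b ` {..<m}. u v *s v)"
    using assms(2) by (auto simp: vec.span_finite)
  then have "z = (\<Sum>j<m. u (b j) *s b j)" by (simp add: sum.reindex assms(1))
  then show ?thesis by (rule that)
qed

lemma independent_image_lessThanD:
  fixes b :: "nat \<Rightarrow> complex ^ 'n::finite"
  assumes "inj_on b {..<m}" "vec.independent (b ` {..<m})" "(\<Sum>j<m. y j *s b j) = 0" "j < m"
  shows "y j = 0"
proof -
  have "(\<Sum>v\<in>b ` {..<m}. y (the_inv_into {..<m} b v) *s v) = (\<Sum>j<m. y j *s b j)"
    by (simp add: sum.reindex assms(1) the_inv_into_f_f)
  then have "y (the_inv_into {..<m} b (b j)) = 0"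
    using vec.independentD[OF assms(2), of "b ` {..<m}" "\<lambda>v. y (the_inv_into {..<m} b v)" "b j"] assms(3,4)
    by auto
  then show ?thesis using assms(1,4) by (simp add: the_inv_into_f_f)
qed

text \<open>Extends a basis of \<open>U\<close> to one of \<open>K\<close> and numbers it so that
  the vectors of \<open>U\<close> come first.\<close>

lemma adapted_basis:
  fixes U K :: "(complex ^ 'n::finite) set"
  assumes U: "vec.subspace U" and K: "vec.subspace K" and "U \<subseteq> K"
  obtains b :: "nat \<Rightarrow> complex ^ 'n"
  where "inj_on b {..<vec.dim K}" "vec.independent (b ` {..<vec.dim K})"
    "vec.span (b ` {..<vec.dim K}) = K" "vec.span (b ` {..<vec.dim U}) = U"
    "vec.dim U \<le> vec.dim K"
proof -
  obtain B0 where B0: "B0 \<subseteq> U" "vec.independent B0" "U \<subseteq> vec.span B0" "card B0 = vec.dim U"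
    using vec.basis_exists by blast
  obtain B where B: "B0 \<subseteq> B" "B \<subseteq> K" "vec.independent B" "K \<subseteq> vec.span B"
    using vec.maximal_independent_subset_extend[of B0 K] B0(1,2) \<open>U \<subseteq> K\<close> by blast
  have fin: "finite B" using B(3) vec.finiteI_independent by blast
  have cB: "card B = vec.dim K" using B vec.basis_card_eq_dim by blast
  have sB: "vec.span B = K" using B K vec.span_minimal by blast
  have sB0: "vec.span B0 = U" using B0 U vec.span_minimal by blast
  let ?p = "vec.dim U" and ?q = "vec.dim K"
  have pq: "?p \<le> ?q" using B(1) fin cB B0(4) card_mono by metis
  obtain f where f: "bij_betw f {0..<?p} B0"
    using ex_bij_betw_nat_finite[of B0] B0(4) B(1) fin finite_subset by metis
  have "card (B - B0) = ?q - ?p" using B(1) fin cB B0(4) finite_subset card_Diff_subset by metis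
  then obtain g where g: "bij_betw g {0..<?q - ?p} (B - B0)"
    using ex_bij_betw_nat_finite[of "B - B0"] fin by auto
  define b where "b j = (if j < ?p then f j else g (j - ?p))" for j
  have "bij_betw b {..<?p} B0"
    using f by (subst bij_betw_cong[where g=f]) (auto simp: b_def atLeast0LessThan)
  moreover have "bij_betw b {?p..<?q} (B - B0)"
  proof -
    have "bij_betw (\<lambda>j. j - ?p) {?p..<?q} {0..<?q - ?p}"
      by (rule bij_betw_byWitness[where f'="\<lambda>j. j + ?p"]) auto
    from bij_betw_trans[OF this g] show ?thesis
      by (subst bij_betw_cong[where g="g \<circ> (\<lambda>j. j - ?p)"]) (auto simp: b_def)
  qed
  ultimately have "bij_betw b ({..<?p} \<union> {?p..<?q}) (B0 \<union> (B - B0))"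
    by (rule bij_betw_combine) auto
  moreover have "{..<?p} \<union> {?p..<?q} = {..<?q}" using pq by auto
  moreover have "B0 \<union> (B - B0) = B" using B(1) by blast
  ultimately have b: "bij_betw b {..<?q} B" by simp
  show ?thesis
  proof (rule that)
    show "inj_on b {..<?q}" using b by (simp add: bij_betw_def)
    have "b ` {..<?q} = B" using b by (simp add: bij_betw_def)
    then show "vec.independent (b ` {..<?q})" "vec.span (b ` {..<?q}) = K" using B(3) sB by auto
    show "vec.span (b ` {..<?p}) = U"
      using \<open>bij_betw b {..<?p} B0\<close> sB0 by (simp add: bij_betw_def)
  qed (rule pq)
qed

text \<open>In a basis of the hyperplane whose first \<open>k + 1\<close> vectors span
  \<open>U\<close>, invariance along \<open>U\<close> says that the restricted form is free of the
  variables 0 to \<open>k\<close>; so it is itself the cone equation. The vector \<open>z\<close>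
  ensures that it is nonzero.\<close>

lemma cone_coordinates:
  fixes F :: "'n::finite cpoly"
  assumes hom: "homogeneous d F" and "a \<noteq> 0" and U: "vec.subspace U" "U \<subseteq> vtx F (kerd a)"
    and dimU: "vec.dim U = k + 1" and nz: "z \<in> kerd a" "ev F z \<noteq> 0"
  obtains b where "coordinates_on {L \<in> proj_space. L \<subseteq> kerd a} b"
    "{L \<in> proj_space. L \<subseteq> U} =
       zeros_on {L \<in> proj_space. L \<subseteq> kerd a} b (Var ` {k<..<CARD('n) - 1})"
    "homogeneous d (restrict_form F b)" "restrict_form F b \<noteq> 0"
    "vars (restrict_form F b) \<subseteq> {k<..<CARD('n) - 1}"
proof -
  let ?K = "kerd a" and ?n = "CARD('n) - 1"
  have K: "vec.subspace ?K" by (rule subspace_kerd)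
  have dimK: "vec.dim ?K = ?n" using dim_kerd[OF \<open>a \<noteq> 0\<close>] by simp
  have UK: "U \<subseteq> ?K" using U(2) by (auto simp: vtx_def)
  obtain b where b: "inj_on b {..<?n}" "vec.independent (b ` {..<?n})"
    "vec.span (b ` {..<?n}) = ?K" "vec.span (b ` {..<k + 1}) = U" "k + 1 \<le> ?n"
    using adapted_basis[OF U(1) K UK] unfolding dimK dimU by blast
  have sumK: "(\<Sum>j<?n. y j *s b j) \<in> ?K" for y
    unfolding b(3)[symmetric]
    by (intro vec.span_sum vec.span_scale vec.span_base) auto
  let ?G = "restrict_form F b"
  show ?thesis
  proof (rule that[of b])
    show "coordinates_on {L \<in> proj_space. L \<subseteq> ?K} b"
      using b by (simp add: coordinates_on_def)
    show "homogeneous d ?G" by (rule homogeneous_restrict_form[OF hom])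
    obtain y where "z = (\<Sum>j<?n. y j *s b j)"
      using in_span_image_lessThan[OF b(1)] nz(1) b(3) by metis
    then have "peval ?G y \<noteq> 0" using nz(2) by (simp add: peval_restrict_form)
    then show "?G \<noteq> 0" by auto
    show "vars ?G \<subseteq> {k<..<?n}"
    proof
      fix j assume j: "j \<in> vars ?G"
      show "j \<in> {k<..<?n}"
      proof (rule ccontr)
        assume nj: "j \<notin> {k<..<?n}"
        \<comment> \<open>For \<open>j\<close> up to \<open>k\<close> the change of coordinate is a
          translation along \<open>U\<close>; for \<open>j\<close> beyond the basis the coordinate
          does not occur in the sum.\<close>
        have "peval ?G (y(j := c)) = peval ?G y" for y c
        proof (cases "j < ?n")
          case True
          then have "j < k + 1" using nj by simp
          then have "b j \<in> U" unfolding b(4)[symmetric] by (intro vec.span_base) auto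
          then have v: "(c - y j) *s b j \<in> vtx F ?K"
            using U by (meson subsetD vec.subspace_scale)
          have "(\<Sum>i<?n. (y(j := c)) i *s b i) =
              (\<Sum>i<?n. y i *s b i + (if i = j then (c - y j) *s b j else 0))"
            by (intro sum.cong) (auto simp: algebra_simps vec.scale_left_diff_distrib)
          also have "\<dots> = (\<Sum>i<?n. y i *s b i) + (c - y j) *s b j"
            using True by (simp add: sum.distrib)
          finally show ?thesis
            unfolding peval_restrict_form using vtx_translate[OF K v sumK] by simp
        next
          case False
          then have "(\<Sum>i<?n. (y(j := c)) i *s b i) = (\<Sum>i<?n. y i *s b i)"
            by (intro sum.cong) auto
          then show ?thesis by (simp add: peval_restrict_form)
        qed
        from not_in_vars[OF this] j show False by blast
      qed
    qed
    show "{L \<in> proj_space. L \<subseteq> U} =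
       zeros_on {L \<in> proj_space. L \<subseteq> ?K} b (Var ` {k<..<?n})"
    proof -
      have "L \<subseteq> U \<longleftrightarrow> (\<forall>y. (\<Sum>j<?n. y j *s b j) \<in> L \<longrightarrow> (\<forall>j\<in>{k<..<?n}. y j = 0))"
        if LK: "L \<subseteq> ?K" for L
      proof
        assume L: "L \<subseteq> U"
        show "\<forall>y. (\<Sum>j<?n. y j *s b j) \<in> L \<longrightarrow> (\<forall>j\<in>{k<..<?n}. y j = 0)"
        proof (intro allI impI ballI)
          fix y j assume y: "(\<Sum>j<?n. y j *s b j) \<in> L" and j: "j \<in> {k<..<?n}"
          then have "(\<Sum>j<?n. y j *s b j) \<in> vec.span (b ` {..<k + 1})" using L b(4) by blast
          moreover have "inj_on b {..<k + 1}" using b(1,5) by (auto intro: inj_on_subset)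
          ultimately obtain x where x: "(\<Sum>j<?n. y j *s b j) = (\<Sum>j<k + 1. x j *s b j)"
            using in_span_image_lessThan by metis
          also have "\<dots> = (\<Sum>j<?n. (if j < k + 1 then x j else 0) *s b j)"
            using b(5) by (intro sum.mono_neutral_cong_left) auto
          finally have "(\<Sum>j<?n. (y j - (if j < k + 1 then x j else 0)) *s b j) = 0"
            by (simp only: vec.scale_left_diff_distrib sum_subtractf) simp
          from independent_image_lessThanD[OF b(1,2) this, of j] j
          show "y j = 0" by auto
        qed
      next
        assume *: "\<forall>y. (\<Sum>j<?n. y j *s b j) \<in> L \<longrightarrow> (\<forall>j\<in>{k<..<?n}. y j = 0)"
        show "L \<subseteq> U"
        proof
          fix w assume w: "w \<in> L"
          then obtain y where y: "w = (\<Sum>j<?n. y j *s b j)"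
            using in_span_image_lessThan[OF b(1)] LK b(3) by (metis subsetD)
          have "y j *s b j \<in> U" if "j < ?n" for j
          proof (cases "j < k + 1")
            case True
            then have "b j \<in> U" unfolding b(4)[symmetric] by (intro vec.span_base) auto
            then show ?thesis using U(1) by (simp add: vec.subspace_scale)
          next
            case False
            then have "y j = 0" using * w y that by auto
            then show ?thesis using U(1) by (simp add: vec.subspace_0)
          qed
          then show "w \<in> U" unfolding y using U(1) by (intro vec.subspace_sum) auto
        qed
      qed
      then show ?thesis using UK by (auto simp: zeros_on_def)
    qed
  qed
qed

lemma cone_with_vertex:
  fixes F :: "'n::finite cpoly"
  assumes "homogeneous d F" "a \<noteq> 0" "vec.subspace U" "U \<subseteq> vtx F (kerd a)"
    "vec.dim U = k + 1" "z \<in> kerd a" "ev F z \<noteq> 0"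
  shows "is_cone_with_vertex d F {L \<in> proj_space. L \<subseteq> kerd a} k {L \<in> proj_space. L \<subseteq> U}"
proof -
  obtain b where "coordinates_on {L \<in> proj_space. L \<subseteq> kerd a} b"
    "{L \<in> proj_space. L \<subseteq> U} =
       zeros_on {L \<in> proj_space. L \<subseteq> kerd a} b (Var ` {k<..<CARD('n) - 1})"
    "homogeneous d (restrict_form F b)" "restrict_form F b \<noteq> 0"
    "vars (restrict_form F b) \<subseteq> {k<..<CARD('n) - 1}"
    using cone_coordinates[OF assms] by blast
  moreover have "same_zero_scheme (restrict_form F b) (restrict_form F b)"
    unfolding same_zero_scheme_def by (rule exI[of _ 1]) simp
  ultimately show ?thesis unfolding is_cone_with_vertex_def by blast
qed

text \<open>By homogeneity, the value at \<open>x\<close> is \<open>x j ^ d\<close> times the value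
  at the all-one point.\<close>

lemma homogeneous_single_variable:
  assumes "homogeneous d G" "vars G \<subseteq> {j}"
  shows "\<exists>c. G = const c * Var j ^ d"
proof -
  have "peval G x = peval (const (peval G (\<lambda>_. 1)) * Var j ^ d) x" for x
  proof -
    have "peval G x = peval G (\<lambda>i. x j * 1)"
      by (rule peval_cong_vars) (use assms(2) in auto)
    also have "\<dots> = x j ^ d * peval G (\<lambda>_. 1)" by (rule peval_scale[OF assms(1)])
    finally show ?thesis by (simp add: peval_mult peval_power mult.commute)
  qed
  then show ?thesis using cpoly_eqI by blast
qed

lemma section_multiple:
  fixes F :: "'n::finite cpoly"
  assumes "homogeneous d F" "a \<noteq> 0" "vec.subspace U" "U \<subseteq> vtx F (kerd a)"
    "vec.dim U = k + 1" "z \<in> kerd a" "ev F z \<noteq> 0" and k: "CARD('n) = k + 3"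
  shows "section_eq_multiple F {L \<in> proj_space. L \<subseteq> kerd a} d {L \<in> proj_space. L \<subseteq> U}"
proof -
  obtain b where b: "coordinates_on {L \<in> proj_space. L \<subseteq> kerd a} b"
    "{L \<in> proj_space. L \<subseteq> U} =
       zeros_on {L \<in> proj_space. L \<subseteq> kerd a} b (Var ` {k<..<CARD('n) - 1})"
    "homogeneous d (restrict_form F b)" "restrict_form F b \<noteq> 0"
    "vars (restrict_form F b) \<subseteq> {k<..<CARD('n) - 1}"
    using cone_coordinates[OF assms(1-7)] by blast
  \<comment> \<open>The hyperplane has coordinates with indices 0 to \<open>k + 1\<close>, of which
    only the last may occur in the cone equation.\<close>
  have eq: "{k<..<CARD('n) - 1} = {k + 1}" using k by auto
  have zeros: "{L \<in> proj_space. L \<subseteq> U} =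
      zeros_on {L \<in> proj_space. L \<subseteq> kerd a} b {Var (k + 1)}"
    using b(2) unfolding eq by simp
  obtain c where c: "restrict_form F b = const c * Var (k + 1) ^ d"
    using homogeneous_single_variable[OF b(3) b(5)[unfolded eq]] by blast
  with b(4) have "c \<noteq> 0" by auto
  with c have "same_zero_scheme (restrict_form F b) (Var (k + 1) ^ d)"
    unfolding same_zero_scheme_def by blast
  moreover have "homogeneous 1 (Var (k + 1) :: nat cpoly)" by (simp only: One_nat_def homogeneous_Var)
  moreover have "(Var (k + 1) :: nat cpoly) \<noteq> 0"
    by (metis peval_Var[of "k + 1" "\<lambda>_. 1"] peval_zero zero_neq_one)
  moreover have "vars (Var (k + 1) :: nat cpoly) \<subseteq> {..<CARD('n) - 1}"
    using k by (simp add: vars_def Var_def)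
  ultimately show ?thesis
    unfolding section_eq_multiple_def using b(1) zeros by blast
qed

section \<open>Tangent hyperplanes, smooth points and star points on representatives\<close>

lemma tangent_hyperplane_span:
  fixes F :: "'n::finite cpoly"
  assumes hom: "homogeneous d F" and "v \<noteq> 0"
  shows "tangent_hyperplane F (vec.span {v}) = {Q \<in> proj_space. Q \<subseteq> kerd (grad F v)}"
proof -
  \<comment> \<open>Other representatives only rescale the differential, so \<open>v\<close> decides
    for all of them.\<close>
  have "dotp (grad F v') w = 0" if "v' \<in> vec.span {v}" "dotp (grad F v) w = 0" for v' w
    using that grad_scale[OF hom] by (auto simp: vec.span_singleton dotp_simps)
  moreover have "v \<in> vec.span {v} - {0}" using assms(2) vec.span_base by blast
  ultimately have "(\<forall>v'\<in>vec.span {v} - {0}. \<forall>w\<in>Q. dotp (grad F v') w = 0) \<longleftrightarrow>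
      (\<forall>w\<in>Q. dotp (grad F v) w = 0)" for Q by blast
  then show ?thesis
    by (simp add: tangent_hyperplane_def dotp_def grad_def kerd_def subset_eq)
qed

lemma smooth_point_span:
  fixes F :: "'n::finite cpoly"
  assumes hom: "homogeneous d F" and "v \<noteq> 0"
  shows "smooth_point F (vec.span {v}) \<longleftrightarrow> ev F v = 0 \<and> grad F v \<noteq> 0"
proof -
  have "vec.span {v} \<in> proj_zeros {F} \<longleftrightarrow> ev F v = 0"
    using span_singleton_in_proj_space[OF assms(2)] vanishes_on_span_iff[OF hom, of v]
    by (simp add: proj_zeros_def)
  moreover have "(\<exists>v'\<in>vec.span {v} - {0}. grad F v' \<noteq> 0) \<longleftrightarrow> grad F v \<noteq> 0"
  proof -
    have "grad F v' = 0" if "v' \<in> vec.span {v}" "grad F v = 0" for v'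
      using that grad_scale[OF hom] by (auto simp: vec.span_singleton)
    moreover have "v \<in> vec.span {v} - {0}" using assms(2) vec.span_base by blast
    ultimately show ?thesis by blast
  qed
  moreover have "grad F v' \<noteq> 0 \<longleftrightarrow> (\<exists>i. peval (partial_deriv i F) (($) v') \<noteq> 0)" for v'
    by (simp add: grad_def vec_eq_iff)
  ultimately show ?thesis by (simp add: smooth_point_def)
qed

text \<open>From left to right, the vertex \<open>{P}\<close> forces all coordinates of
  \<open>v\<close> except the 0-th to vanish, so the cone equation does not see a translation by
  \<open>v\<close>. From right to left, \<open>cone_with_vertex\<close> applies to the line spanned
  by \<open>v\<close>.\<close>

lemma star_point_span:
  fixes F :: "'n::finite cpoly"
  assumes hom: "homogeneous d F" and "d \<ge> 2" and irr: "irreducible F" and "v \<noteq> 0"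
  shows "star_point d F (vec.span {v}) \<longleftrightarrow> is_star F v"
proof
  assume "star_point d F (vec.span {v})"
  then have "smooth_point F (vec.span {v})"
    and cone: "is_cone_with_vertex d F {Q \<in> proj_space. Q \<subseteq> kerd (grad F v)} 0 {vec.span {v}}"
    by (simp_all add: star_point_def tangent_hyperplane_span[OF hom \<open>v \<noteq> 0\<close>])
  then have v: "ev F v = 0" "grad F v \<noteq> 0"
    using smooth_point_span[OF hom \<open>v \<noteq> 0\<close>] by blast+
  let ?K = "kerd (grad F v)" and ?n = "CARD('n) - 1"
  obtain b G where b: "coordinates_on {Q \<in> proj_space. Q \<subseteq> ?K} b"
    and zeros: "{vec.span {v}} = zeros_on {Q \<in> proj_space. Q \<subseteq> ?K} b (Var ` {0<..<?n})"
    and G: "vars G \<subseteq> {0<..<?n}" "same_zero_scheme (restrict_form F b) G"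
    using cone unfolding is_cone_with_vertex_def by blast
  have inj: "inj_on b {..<?n}" using b by (simp add: coordinates_on_def)
  have K: "vec.span (b ` {..<?n}) = ?K"
    using b subspace_eqI_lines[OF subspace_kerd vec.subspace_span, of "grad F v" "b ` {..<?n}"]
    by (simp add: coordinates_on_def)
  have vK: "v \<in> ?K" using grad_dotp_self[OF hom, of v] v by (simp add: kerd_def)
  obtain x where x: "v = (\<Sum>j<?n. x j *s b j)"
    using in_span_image_lessThan[OF inj] vK K by metis
  have "vec.span {v} \<in> zeros_on {Q \<in> proj_space. Q \<subseteq> ?K} b (Var ` {0<..<?n})"
    using zeros by blast
  then have x0: "x j = 0" if "j \<in> {0<..<?n}" for j
    using that x vec.span_base[of v "{v}"] by (auto simp: zeros_on_def)
  obtain c where c: "restrict_form F b = const c * G"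
    using G(2) by (auto simp: same_zero_scheme_def)
  show "is_star F v"
    unfolding is_star_def
  proof (intro conjI v(2) vtxI vK)
    fix z t assume "z \<in> ?K"
    then obtain y where y: "z = (\<Sum>j<?n. y j *s b j)"
      using in_span_image_lessThan[OF inj] K by metis
    have zt: "z + t *s v = (\<Sum>j<?n. (y j + t * x j) *s b j)"
      unfolding y x by (simp add: sum.distrib vec.scale_sum_right vec.scale_left_distrib)
    have "ev F (z + t *s v) = c * peval G (\<lambda>j. y j + t * x j)"
      unfolding zt peval_restrict_form[symmetric] c by (simp add: peval_mult)
    also have "peval G (\<lambda>j. y j + t * x j) = peval G y"
      by (rule peval_cong_vars) (use G(1) x0 in auto)
    also have "c * peval G y = ev F z"
      unfolding y peval_restrict_form[symmetric] c by (simp add: peval_mult)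
    finally show "ev F (z + t *s v) = ev F z" .
  qed
next
  assume star: "is_star F v"
  then have v: "grad F v \<noteq> 0" "v \<in> vtx F (kerd (grad F v))" by (auto simp: is_star_def)
  have "ev F v = 0"
    using vtx_zero[OF subspace_kerd v(2) hom] \<open>d \<ge> 2\<close> by simp
  then have "smooth_point F (vec.span {v})"
    using smooth_point_span[OF hom \<open>v \<noteq> 0\<close>] v(1) by simp
  moreover have "is_cone_with_vertex d F {L \<in> proj_space. L \<subseteq> kerd (grad F v)} 0
      {L \<in> proj_space. L \<subseteq> vec.span {v}}"
  proof -
    obtain z where z: "z \<in> kerd (grad F v)" "ev F z \<noteq> 0"
      using irreducible_not_zero_on_hyperplane[OF hom \<open>d \<ge> 2\<close> irr v(1)] by blast
    have "vec.dim (vec.span {v}) = 0 + 1"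
      using span_singleton_in_proj_space[OF \<open>v \<noteq> 0\<close>] by (simp add: proj_space_def)
    moreover have "vec.span {v} \<subseteq> vtx F (kerd (grad F v))"
      by (subst span_singleton_subset_iff) (simp_all add: v(2) subspace_vtx subspace_kerd)
    ultimately show ?thesis
      by (intro cone_with_vertex[OF hom v(1) _ _ _ z] vec.subspace_span)
  qed
  moreover have "{L \<in> proj_space. L \<subseteq> vec.span {v}} = {vec.span {v}}"
  proof -
    have "L = vec.span {v}" if L: "L \<in> proj_space" "L \<subseteq> vec.span {v}" for L
    proof -
      obtain u where u: "u \<noteq> 0" "L = vec.span {u}" using L(1) by (auto simp: proj_space_eq_span)
      then have "u \<in> vec.span {v}" using L(2) vec.span_base by blast
      then show ?thesis
        using proj_space_nonzero[OF span_singleton_in_proj_space[OF \<open>v \<noteq> 0\<close>]] u by blast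
    qed
    then show ?thesis using span_singleton_in_proj_space[OF \<open>v \<noteq> 0\<close>] by blast
  qed
  ultimately show "star_point d F (vec.span {v})"
    by (simp add: star_point_def tangent_hyperplane_span[OF hom \<open>v \<noteq> 0\<close>])
qed

section \<open>Local constancy of the tangent hyperplane\<close>

text \<open>Dividing by \<open>n ^ 2 * \<omega> n\<close> sends the right-hand side to 0, while the
  left-hand side keeps the factor \<open>n ^ (e - 2)\<close> of modulus at least 1. So
  \<open>\<alpha> + n \<beta>\<close> tends to 0, and differences of consecutive terms give
  \<open>\<beta> = 0\<close>.\<close>

lemma affine_growth:
  fixes \<alpha> \<beta> a b :: complex
  assumes eq: "\<And>n. n > 0 \<Longrightarrow> (\<alpha> + of_nat n * \<beta>) * of_nat n ^ e * \<omega> n = a + of_nat n * b"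
    and "e \<ge> 2" and chi: "\<omega> \<longlonglongrightarrow> 1"
  shows "\<alpha> = 0" "\<beta> = 0"
proof -
  let ?n = "\<lambda>n. of_nat n :: complex"
  have "(\<lambda>n. (a * inverse (?n n) + b) * inverse (?n n)) \<longlonglongrightarrow> (a * 0 + b) * 0"
    by (intro tendsto_intros lim_inverse_n)
  then have "(\<lambda>n. (a * inverse (?n n) + b) * inverse (?n n) / \<omega> n) \<longlonglongrightarrow> (a * 0 + b) * 0 / 1"
    by (intro tendsto_divide chi) simp_all
  moreover have "\<forall>\<^sub>F n in sequentially.
      (a * inverse (?n n) + b) * inverse (?n n) / \<omega> n = (\<alpha> + ?n n * \<beta>) * ?n n ^ (e - 2)"
  proof -
    have "\<forall>\<^sub>F n in sequentially. \<omega> n \<noteq> 0"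
      using tendsto_imp_eventually_ne[OF chi] by simp
    then show ?thesis using eventually_gt_at_top[of 0]
    proof eventually_elim
      case (elim n)
      have "?n n ^ e = ?n n ^ (e - 2) * ?n n ^ 2"
        using \<open>e \<ge> 2\<close> by (metis le_add_diff_inverse2 power_add)
      then show ?case using elim eq[of n]
        by (simp add: field_simps power2_eq_square)
    qed
  qed
  ultimately have "(\<lambda>n. (\<alpha> + ?n n * \<beta>) * ?n n ^ (e - 2)) \<longlonglongrightarrow> 0"
    using Lim_transform_eventually by force
  then have lim: "(\<lambda>n. \<alpha> + ?n n * \<beta>) \<longlonglongrightarrow> 0"
  proof (rule Lim_null_comparison[rotated, OF tendsto_norm_zero])
    show "\<forall>\<^sub>F n in sequentially. norm (\<alpha> + ?n n * \<beta>) \<le> norm ((\<alpha> + ?n n * \<beta>) * ?n n ^ (e - 2))"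
      using eventually_gt_at_top[of 0]
    proof eventually_elim
      case (elim n)
      then have "1 \<le> norm (?n n ^ (e - 2))"
        by (simp add: norm_power one_le_power)
      then show ?case unfolding norm_mult by (simp add: mult_le_cancel_left1)
    qed
  qed
  have "(\<lambda>n. (\<alpha> + ?n (Suc n) * \<beta>) - (\<alpha> + ?n n * \<beta>)) \<longlonglongrightarrow> 0 - 0"
    using LIMSEQ_Suc[OF lim] lim by (rule tendsto_diff)
  then have "(\<lambda>n::nat. \<beta>) \<longlonglongrightarrow> 0" by (simp add: algebra_simps)
  then show "\<beta> = 0" by (simp add: LIMSEQ_const_iff)
  then show "\<alpha> = 0" using lim by (simp add: LIMSEQ_const_iff)
qed

section \<open>Scaling of covectors and second derivatives\<close>

lemma tendsto_vector_scale [tendsto_intros]: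
  fixes f :: "'a \<Rightarrow> complex ^ 'n"
  assumes "(c \<longlongrightarrow> k) G" "(f \<longlongrightarrow> v) G"
  shows "((\<lambda>x. c x *s f x) \<longlongrightarrow> k *s v) G"
  by (intro vec_tendstoI) (simp add: tendsto_mult tendsto_vec_nth assms)

lemma dotp_scaleR: "dotp (r *\<^sub>R a) v = of_real r * dotp a v"
  unfolding dotp_def by (simp add: sum_distrib_left scaleR_conv_of_real[where 'a=complex] mult.assoc)

lemma kerd_scale: "c \<noteq> 0 \<Longrightarrow> kerd (c *s a) = kerd a"
  by (simp add: kerd_def dotp_simps)

lemma dotp_eq_0I: "(\<And>v. dotp a v = 0) \<Longrightarrow> a = 0"
  by (metis dotp_surj zero_neq_one)

text \<open>The Hessian matrix at \<open>z\<close> applied to \<open>u\<close>, that is, the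
  derivative of \<open>grad F\<close> at \<open>z\<close> in direction \<open>u\<close>.\<close>

definition hess :: "'n::finite cpoly \<Rightarrow> complex ^ 'n \<Rightarrow> complex ^ 'n \<Rightarrow> complex ^ 'n" where
  "hess F z u = (\<chi> i. dotp (grad (partial_deriv i F) z) u)"

lemma hess_sym: "dotp (hess F z u) v = dotp (hess F z v) u"
proof -
  have eq: "dotp (hess F z u) v =
      (\<Sum>i\<in>UNIV. \<Sum>j\<in>UNIV. ev (partial_deriv j (partial_deriv i F)) z * u $ j * v $ i)"
    for u v :: "complex ^ 'a"
    by (simp add: hess_def dotp_def grad_def sum_distrib_right)
  then show ?thesis
    unfolding eq[of u v] eq[of v u]
    by (subst sum.swap) (intro sum.cong refl, subst partial_deriv_commute, simp only: mult_ac)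
qed

text \<open>Caratheodory's form of differentiability avoids dividing by \<open>s\<close>. The limit
  is in \<open>nhds 0\<close>, as the parameters inserted later may be 0.\<close>

lemma grad_difference_quotient:
  fixes F :: "'n::finite cpoly"
  obtains \<rho> where "\<And>s. grad F (z + s *s u) = grad F z + s *s \<rho> s" "(\<rho> \<longlongrightarrow> hess F z u) (nhds 0)"
proof -
  have "\<exists>g. (\<forall>s. ev (partial_deriv i F) (z + s *s u) - ev (partial_deriv i F) (z + 0 *s u) = g s * (s - 0))
      \<and> isCont g 0 \<and> g 0 = dotp (grad (partial_deriv i F) z) u" for i
    using ev_line_deriv[of "partial_deriv i F" z u 0] by (simp add: DERIV_caratheodory_within)
  then obtain g where g: "\<And>i s. ev (partial_deriv i F) (z + s *s u) - ev (partial_deriv i F) z = g i s * s"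
    "\<And>i. isCont (g i) 0" "\<And>i. g i 0 = dotp (grad (partial_deriv i F) z) u"
    by simp metis
  show ?thesis
  proof (rule that[of "\<lambda>s. \<chi> i. g i s"])
    show "grad F (z + s *s u) = grad F z + s *s (\<chi> i. g i s)" for s
      using g(1) by (simp add: grad_def vec_eq_iff algebra_simps)
    have "(g i \<longlongrightarrow> g i 0) (nhds 0)" for i
      using g(2)[of i] by (simp add: isCont_def tendsto_at_iff_tendsto_nhds)
    then show "((\<lambda>s. \<chi> i. g i s) \<longlongrightarrow> hess F z u) (nhds 0)"
      by (intro vec_tendstoI) (simp add: hess_def g(3))
  qed
qed

lemma grad_line_deriv:
  "((\<lambda>t. dotp (grad F (w + t *s p)) u) has_field_derivative dotp (hess F (w + t *s p) p) u) (at t)"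
proof -
  have "((\<lambda>t. \<Sum>i\<in>UNIV. ev (partial_deriv i F) (w + t *s p) * u $ i) has_field_derivative
     (\<Sum>i\<in>UNIV. dotp (grad (partial_deriv i F) (w + t *s p)) p * u $ i)) (at t)"
    by (intro DERIV_sum DERIV_cmult_right ev_line_deriv)
  then show ?thesis by (simp add: dotp_def hess_def grad_def)
qed

text \<open>\<open>F(w + p + s x)\<close> and \<open>F(w + s x)\<close> agree for all
  \<open>s\<close> by invariance; compare their derivatives at \<open>s = 0\<close>.\<close>

lemma grad_translate:
  assumes K: "vec.subspace K" and "p \<in> vtx F K" "w \<in> K" "x \<in> K"
  shows "dotp (grad F (w + p)) x = dotp (grad F w) x"
proof -
  have "ev F (w + p + s *s x) = ev F (w + s *s x)" for s
    using vtx_translate[OF K assms(2), of "w + s *s x"] assms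
    by (simp add: add_ac vec.subspace_add vec.subspace_scale)
  then have "((\<lambda>s. ev F (w + s *s x)) has_field_derivative dotp (grad F (w + p)) x) (at 0)"
    using ev_line_deriv[of F "w + p" x 0] by simp
  moreover have "((\<lambda>s. ev F (w + s *s x)) has_field_derivative dotp (grad F w) x) (at 0)"
    using ev_line_deriv[of F w x 0] by simp
  ultimately show ?thesis using DERIV_unique by blast
qed

text \<open>By symmetry of the Hessian, the assumption says that
  \<open>\<eta>(w + t p) D\<^sub>uF(w + t p)\<close> has constant derivative \<open>b\<close> in
  \<open>t\<close>. By homogeneity the second factor at \<open>t = n\<close> is
  \<open>n ^ (d - 1)\<close> times a quantity tending to \<open>D\<^sub>uF(p) = 1\<close>, so
  \<open>affine_growth\<close> applies.\<close>

lemma limit_direction_zero: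
  assumes hom: "homogeneous d F" and "d \<ge> 3" and u: "dotp (grad F p) u = 1"
    and const: "\<And>t. dotp \<eta> p * dotp (grad F (w + t *s p)) u +
        dotp \<eta> (w + t *s p) * dotp (hess F (w + t *s p) u) p = b"
  shows "dotp \<eta> w = 0"
proof -
  let ?\<phi> = "\<lambda>t. dotp (grad F (w + t *s p)) u"
  define \<Psi> where "\<Psi> t = (dotp \<eta> w + t * dotp \<eta> p) * ?\<phi> t - t * b" for t
  have "(\<Psi> has_field_derivative 0) (at t within UNIV)" for t
    unfolding \<Psi>_def using const[of t]
    by (auto intro!: derivative_eq_intros grad_line_deriv
        simp: dotp_simps hess_sym[of F "w + t *s p" p u] algebra_simps)
  then obtain a where a: "\<And>t. \<Psi> t = a"
    using has_field_derivative_zero_constant[of UNIV \<Psi>] by auto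
  define \<omega> where "\<omega> n = dotp (grad F (p + inverse (of_nat n) *s w)) u" for n :: nat
  have "(dotp \<eta> w + of_nat n * dotp \<eta> p) * of_nat n ^ (d - 1) * \<omega> n = a + of_nat n * b"
    if "n > 0" for n
  proof -
    have "w + of_nat n *s p = of_nat n *s (p + inverse (of_nat n) *s w)"
      using that by (simp add: vec.scale_right_distrib add.commute)
    then have "?\<phi> (of_nat n) = of_nat n ^ (d - 1) * \<omega> n"
      by (simp only: grad_scale[OF hom] dotp_simps \<omega>_def)
    then show ?thesis using a[of "of_nat n"] by (simp add: \<Psi>_def algebra_simps)
  qed
  moreover have "\<omega> \<longlonglongrightarrow> 1"
  proof -
    have "(\<lambda>n. p + inverse (of_nat n) *s w) \<longlonglongrightarrow> p + 0 *s w"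
      by (intro tendsto_intros lim_inverse_n)
    then have "\<omega> \<longlonglongrightarrow> dotp (grad F (p + 0 *s w)) u"
      unfolding \<omega>_def by (intro tendsto_dotp tendsto_grad tendsto_const)
    then show ?thesis using u by simp
  qed
  ultimately show ?thesis
    using affine_growth(1)[of "dotp \<eta> w" "dotp \<eta> p" "d - 1" \<omega> a b] \<open>d \<ge> 3\<close> by simp_all
qed

text \<open>Otherwise star vectors with other hyperplanes tend to \<open>p\<close>. The directions
  in which their normalised differentials approach that of \<open>p\<close> have a limit
  \<open>\<eta>\<close> of norm 1 along a subsequence, and the star condition to first order makes
  \<open>\<eta>\<close> vanish on \<open>?K\<close> and at \<open>u\<close>, hence
  everywhere.\<close>

lemma star_hyperplane_locally_constant:
  fixes F :: "'n::finite cpoly"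
  assumes hom: "homogeneous d F" and "d \<ge> 3" and p: "is_star F p"
  shows "\<exists>r>0. \<forall>q. is_star F q \<and> dist q p < r \<longrightarrow> kerd (grad F q) = kerd (grad F p)"
proof (rule ccontr)
  let ?l = "grad F p"
  let ?K = "kerd ?l"
  assume "\<not> ?thesis"
  then have "\<exists>q. is_star F q \<and> dist q p < inverse (real (Suc n)) \<and> kerd (grad F q) \<noteq> ?K" for n
    by (metis inverse_positive_iff_positive of_nat_0_less_iff zero_less_Suc)
  then obtain q0 where q0: "\<And>n. is_star F (q0 n)"
    "\<And>n. dist (q0 n) p < inverse (real (Suc n))" "\<And>n. kerd (grad F (q0 n)) \<noteq> ?K" by metis
  have q0p: "q0 \<longlonglongrightarrow> p"
  proof (rule metric_tendsto_imp_tendsto[OF LIMSEQ_inverse_real_of_nat])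
    show "\<forall>\<^sub>F n in sequentially. dist (q0 n) p \<le> dist (inverse (real (Suc n))) 0"
      using q0(2) by (auto intro!: always_eventually less_imp_le)
  qed
  have l0: "?l \<noteq> 0" and pv: "p \<in> vtx F ?K" using p by (auto simp: is_star_def)
  obtain u where u: "dotp ?l u = 1" using dotp_surj[OF l0] by blast
  \<comment> \<open>Normalised to take the value 1 at \<open>u\<close>. If the differential kills
    \<open>u\<close>, division by zero makes \<open>m0 n\<close> zero; along the subsequence chosen
    below this is excluded for large \<open>n\<close> by \<open>ev_ne\<close>.\<close>
  define m0 where "m0 n = (1 / dotp (grad F (q0 n)) u) *s grad F (q0 n)" for n
  have "m0 n \<noteq> ?l" for n
  proof
    assume "m0 n = ?l"
    moreover from this have "1 / dotp (grad F (q0 n)) u \<noteq> 0"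
      using l0 unfolding m0_def by (metis vec.scale_zero_left)
    ultimately show False using q0(3)[of n] kerd_scale unfolding m0_def by metis
  qed
  then have "norm (m0 n - ?l) \<noteq> 0" for n by simp
  \<comment> \<open>The unit directions lie on a compact sphere, which provides
    \<open>\<eta>\<close> and the subsequence.\<close>
  then have "inverse (norm (m0 n - ?l)) *\<^sub>R (m0 n - ?l) \<in> sphere 0 1" for n
    by simp
  with compact_sphere[of "0 :: complex ^ 'n" 1, unfolded compact_def, rule_format,
      of "\<lambda>n. inverse (norm (m0 n - ?l)) *\<^sub>R (m0 n - ?l)"]
  obtain \<eta> r where \<eta>: "\<eta> \<in> sphere 0 1" and r: "strict_mono r"
    and lim_\<eta>: "((\<lambda>n. inverse (norm (m0 n - ?l)) *\<^sub>R (m0 n - ?l)) \<circ> r) \<longlonglongrightarrow> \<eta>"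
    by blast
  define q where "q = q0 \<circ> r"
  define m where "m = m0 \<circ> r"
  define \<epsilon> where "\<epsilon> n = norm (m n - ?l)" for n
  define h where "h n = inverse (\<epsilon> n) *\<^sub>R (m n - ?l)" for n
  have h: "h \<longlonglongrightarrow> \<eta>" 
  proof -
    have "h = (\<lambda>n. inverse (norm (m0 n - ?l)) *\<^sub>R (m0 n - ?l)) \<circ> r"
      by (rule ext) (simp add: h_def m_def \<epsilon>_def)
    then show ?thesis using lim_\<eta> by simp
  qed
  have \<epsilon>0: "\<epsilon> n \<noteq> 0" for n using \<open>\<And>n. norm (m0 n - ?l) \<noteq> 0\<close> by (simp add: \<epsilon>_def m_def)
  have mh: "m n = ?l + of_real (\<epsilon> n) *s h n" for n
    using \<epsilon>0[of n] unfolding vec_eq_iff h_def by (simp add: scaleR_conv_of_real[where 'a=complex] field_simps)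
  have qp: "q \<longlonglongrightarrow> p" unfolding q_def using q0p r by (rule LIMSEQ_subseq_LIMSEQ)
  have cl: "(\<lambda>n. dotp (grad F (q n)) u) \<longlonglongrightarrow> 1"
    using tendsto_dotp[OF tendsto_grad[OF qp, of F] tendsto_const[of u]] u by simp
  have "m \<longlonglongrightarrow> ?l"
  proof -
    have "m = (\<lambda>n. (1 / dotp (grad F (q n)) u) *s grad F (q n))"
      by (rule ext) (simp add: m_def m0_def q_def)
    moreover have "(\<lambda>n. (1 / dotp (grad F (q n)) u) *s grad F (q n)) \<longlonglongrightarrow> (1 / 1) *s ?l"
      by (intro tendsto_intros cl qp) simp
    ultimately show ?thesis by simp
  qed
  then have "(\<lambda>n. norm (m n - ?l)) \<longlonglongrightarrow> norm (?l - ?l)" by (intro tendsto_intros)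
  then have \<epsilon>lim: "\<epsilon> \<longlonglongrightarrow> 0" unfolding \<epsilon>_def[abs_def] by simp
  have ev_ne: "\<forall>\<^sub>F n in sequentially. dotp (grad F (q n)) u \<noteq> 0"
    using tendsto_imp_eventually_ne[OF cl] by simp
  have normal: "dotp (m n) u = 1" "dotp (m n) (q n) = 0" "kerd (m n) = kerd (grad F (q n))"
    "dotp (h n) u = 0" if ne: "dotp (grad F (q n)) u \<noteq> 0" for n
  proof -
    have m: "m n = (1 / dotp (grad F (q n)) u) *s grad F (q n)" by (simp add: m_def m0_def q_def)
    have "is_star F (q n)" using q0(1) by (simp add: q_def)
    then have "dotp (grad F (q n)) (q n) = 0" by (simp add: is_star_def vtx_def kerd_def)
    then show "dotp (m n) (q n) = 0" by (simp add: m dotp_simps)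
    show 1: "dotp (m n) u = 1" using ne by (simp add: m dotp_simps)
    show "kerd (m n) = kerd (grad F (q n))" unfolding m using ne by (intro kerd_scale) simp
    show "dotp (h n) u = 0" using 1 u by (simp add: h_def dotp_scaleR dotp_simps)
  qed
  have \<eta>u: "dotp \<eta> u = 0"
  proof -
    have "(\<lambda>n. dotp (h n) u) \<longlonglongrightarrow> dotp \<eta> u" by (intro tendsto_intros h)
    moreover have "\<forall>\<^sub>F n in sequentially. dotp (h n) u = 0"
      using ev_ne by eventually_elim (rule normal(4))
    ultimately show ?thesis by (intro LIMSEQ_unique[OF _ tendsto_eventually])
  qed
  have pK: "p \<in> ?K" using pv by (simp add: vtx_def)
  have \<eta>K: "dotp \<eta> w = 0" if w: "w \<in> ?K" for w
  proof -
    \<comment> \<open>\<open>B z\<close> is the first-order term, in units of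
      \<open>\<epsilon> n\<close>, of the star condition for \<open>q n\<close> at points near
      \<open>z\<close>. Projecting \<open>q n\<close> along \<open>u\<close> to \<open>q' n\<close>
      in \<open>?K\<close> brings it within reach of \<open>grad_translate\<close>.\<close>
    define B where "B z = dotp \<eta> p * dotp (grad F z) u + dotp \<eta> z * dotp (hess F z u) p" for z
    define q' where "q' n = q n - dotp ?l (q n) *s u" for n
    have q'K: "q' n \<in> ?K" for n using u by (simp add: q'_def kerd_def dotp_simps)
    have limB: "(\<lambda>n. dotp (grad F z) (q' n) / of_real (\<epsilon> n)) \<longlonglongrightarrow> B z" if z: "z \<in> ?K" for z
    proof -
      obtain \<rho> where \<rho>: "\<And>s. grad F (z + s *s u) = grad F z + s *s \<rho> s"
        and lim\<rho>: "(\<rho> \<longlongrightarrow> hess F z u) (nhds 0)"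
        using grad_difference_quotient[of F z u] by blast
      define s where "s n = of_real (\<epsilon> n) * dotp (h n) z" for n
      have "(\<lambda>n. - s n) \<longlonglongrightarrow> - (of_real 0 * dotp \<eta> z)"
        unfolding s_def by (intro tendsto_intros \<epsilon>lim h)
      then have "filterlim (\<lambda>n. - s n) (nhds 0) sequentially" by simp
      then have lim\<rho>s: "(\<lambda>n. \<rho> (- s n)) \<longlonglongrightarrow> hess F z u"
        by (rule filterlim_compose[OF lim\<rho>])
      have "(\<lambda>n. dotp (h n) (q n) * dotp (grad F z) u + dotp (h n) z * dotp (\<rho> (- s n)) (q n)) \<longlonglongrightarrow> B z"
        unfolding B_def by (intro tendsto_intros h qp lim\<rho>s)
      moreover have "\<forall>\<^sub>F n in sequentially.
          dotp (h n) (q n) * dotp (grad F z) u + dotp (h n) z * dotp (\<rho> (- s n)) (q n) =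
          dotp (grad F z) (q' n) / of_real (\<epsilon> n)"
        using ev_ne
      proof eventually_elim
        case (elim n)
        have star: "is_star F (q n)" using q0(1) by (simp add: q_def)
        have lz: "dotp ?l z = 0" using z by (simp add: kerd_def)
        \<comment> \<open>Since \<open>m n\<close> takes the value \<open>s n\<close> at
          \<open>z\<close> and 1 at \<open>u\<close>, this shift moves \<open>z\<close> into the
          kernel of \<open>m n\<close>, where the star condition for \<open>q n\<close> can be
          used.\<close>
        have "dotp (m n) (z + (- s n) *s u) = 0"
          using normal(1)[OF elim] lz by (simp add: dotp_simps s_def) (simp add: mh dotp_simps lz)
        then have "z + (- s n) *s u \<in> kerd (grad F (q n))"
          using normal(3)[OF elim] by (auto simp: kerd_def)
        then have "dotp (grad F (z + (- s n) *s u)) (q n) = 0"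
          using star by (simp add: is_star_def vtx_def)
        then have 1: "dotp (grad F z) (q n) = s n * dotp (\<rho> (- s n)) (q n)"
          unfolding \<rho> by (simp add: dotp_simps)
        have 2: "dotp ?l (q n) = - of_real (\<epsilon> n) * dotp (h n) (q n)"
          using normal(2)[OF elim] by (simp add: mh dotp_simps eq_neg_iff_add_eq_0)
        have "dotp (grad F z) (q' n) = dotp (grad F z) (q n) - dotp ?l (q n) * dotp (grad F z) u"
          by (simp add: q'_def dotp_simps)
        also have "\<dots> = of_real (\<epsilon> n) *
            (dotp (h n) (q n) * dotp (grad F z) u + dotp (h n) z * dotp (\<rho> (- s n)) (q n))"
          unfolding 1 2 by (simp add: s_def algebra_simps)
        finally show ?case using \<epsilon>0[of n] by simp
      qed
      ultimately show ?thesis by (rule Lim_transform_eventually)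
    qed
    \<comment> \<open>Both sides are limits of the same sequence, because the differentials at
      \<open>w + t p\<close> and \<open>w\<close> agree on \<open>q' n\<close>.\<close>
    have "B (w + t *s p) = B w" for t
    proof -
      have tp: "t *s p \<in> vtx F ?K"
        by (rule vec.subspace_scale[OF subspace_vtx[OF subspace_kerd] pv])
      have "w + t *s p \<in> ?K"
        by (rule vec.subspace_add[OF subspace_kerd w vec.subspace_scale[OF subspace_kerd pK]])
      from limB[OF this] have "(\<lambda>n. dotp (grad F w) (q' n) / of_real (\<epsilon> n)) \<longlonglongrightarrow> B (w + t *s p)"
        by (simp only: grad_translate[OF subspace_kerd tp w q'K])
      then show ?thesis using limB[OF w] by (rule LIMSEQ_unique)
    qed
    then show ?thesis
      using limit_direction_zero[OF hom \<open>d \<ge> 3\<close> u, of \<eta> w "B w"] by (simp add: B_def)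
  qed
  have "dotp \<eta> v = 0" for v
  proof -
    have "v - dotp ?l v *s u \<in> ?K" using u by (simp add: kerd_def dotp_simps)
    from \<eta>K[OF this] \<eta>u show ?thesis by (simp add: dotp_simps)
  qed
  then have "\<eta> = 0" by (rule dotp_eq_0I)
  then show False using \<eta> by simp
qed

text \<open>By Lindelof's theorem, countably many of the balls on which the hyperplane is constant
  cover all star vectors.\<close>

lemma countable_star_hyperplanes:
  fixes F :: "'n::finite cpoly"
  assumes "homogeneous d F" "d \<ge> 3"
  shows "countable {kerd (grad F p) | p. is_star F p}"
proof -
  obtain r where r: "\<And>p. is_star F p \<Longrightarrow> r p > 0 \<and>
      (\<forall>q. is_star F q \<and> dist q p < r p \<longrightarrow> kerd (grad F q) = kerd (grad F p))"
    using star_hyperplane_locally_constant[OF assms] by metis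
  let ?S = "{p. is_star F p}"
  have "\<And>B. B \<in> (\<lambda>p. ball p (r p)) ` ?S \<Longrightarrow> open B" by auto
  from Lindelof[OF this] obtain \<F> where \<F>: "\<F> \<subseteq> (\<lambda>p. ball p (r p)) ` ?S" "countable \<F>"
    "\<Union>\<F> = \<Union>((\<lambda>p. ball p (r p)) ` ?S)" by blast
  then obtain T where T: "countable T" "T \<subseteq> ?S" "\<F> = (\<lambda>p. ball p (r p)) ` T"
    using countable_subset_image[of \<F> "\<lambda>p. ball p (r p)" ?S] by auto
  have "{kerd (grad F p) | p. is_star F p} \<subseteq> (\<lambda>p. kerd (grad F p)) ` T"
  proof clarify
    fix q assume q: "is_star F q"
    then have "q \<in> \<Union>((\<lambda>p. ball p (r p)) ` ?S)" using r[OF q] by auto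
    then have "q \<in> \<Union>\<F>" using \<F>(3) by simp
    then obtain p where "p \<in> T" "q \<in> ball p (r p)" unfolding T(3) by blast
    then have "dist q p < r p" "is_star F p" using T(2) by (auto simp: dist_commute)
    then have "kerd (grad F q) = kerd (grad F p)" using r q by blast
    then show "kerd (grad F q) \<in> (\<lambda>p. kerd (grad F p)) ` T" using \<open>p \<in> T\<close> by blast
  qed
  then show ?thesis by (rule countable_subset) (simp add: T(1))
qed

section \<open>A Nullstellensatz with countably many inequations\<close>

definition ideal :: "'a::comm_ring_1 set \<Rightarrow> bool" where
  "ideal I \<longleftrightarrow> 0 \<in> I \<and> (\<forall>a\<in>I. \<forall>b\<in>I. a + b \<in> I) \<and> (\<forall>a\<in>I. \<forall>r. r * a \<in> I)"

lemma idealD: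
  assumes "ideal I"
  shows "0 \<in> I" "a \<in> I \<Longrightarrow> b \<in> I \<Longrightarrow> a + b \<in> I" "a \<in> I \<Longrightarrow> r * a \<in> I"
    "a \<in> I \<Longrightarrow> a * r \<in> I" "a \<in> I \<Longrightarrow> b \<in> I \<Longrightarrow> a - b \<in> I"
proof -
  show *: "0 \<in> I" "a \<in> I \<Longrightarrow> b \<in> I \<Longrightarrow> a + b \<in> I" "a \<in> I \<Longrightarrow> r * a \<in> I" for a b r
    using assms by (auto simp: ideal_def)
  show "a \<in> I \<Longrightarrow> a * r \<in> I" using *(3)[of a r] by (simp add: mult.commute)
  show "a \<in> I \<Longrightarrow> b \<in> I \<Longrightarrow> a - b \<in> I" using *(2)[of a "- 1 * b"] *(3)[of b "- 1"] by simp
qed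

lemma ideal_sum: "ideal I \<Longrightarrow> (\<And>x. x \<in> A \<Longrightarrow> f x \<in> I) \<Longrightarrow> sum f A \<in> I"
  by (induction A rule: infinite_finite_induct) (auto intro: idealD)

text \<open>Zorn's lemma gives an ideal maximal among those that contain \<open>I\<close> and miss
  \<open>M\<close>. Adjoining an outside element must hit \<open>M\<close>, which is the last
  property; multiplying two such relations gives primality, as \<open>M\<close> is closed under
  products.\<close>

lemma ideal_avoiding_maximal:
  fixes I :: "'a::comm_ring_1 set"
  assumes I: "ideal I" and M: "M \<inter> I = {}" "1 \<in> M" "\<And>a b. a \<in> M \<Longrightarrow> b \<in> M \<Longrightarrow> a * b \<in> M"
  obtains J where "ideal J" "I \<subseteq> J" "M \<inter> J = {}"
    "\<And>a b. a * b \<in> J \<Longrightarrow> a \<in> J \<or> b \<in> J"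
    "\<And>a. a \<notin> J \<Longrightarrow> \<exists>m\<in>M. \<exists>r. m - r * a \<in> J"
proof -
  let ?\<A> = "{J. ideal J \<and> I \<subseteq> J \<and> M \<inter> J = {}}"
  have "\<exists>J\<in>?\<A>. \<forall>J'\<in>?\<A>. J \<subseteq> J' \<longrightarrow> J' = J"
  proof (rule subset_Zorn)
    fix C assume C: "subset.chain ?\<A> C"
    show "\<exists>U\<in>?\<A>. \<forall>X\<in>C. X \<subseteq> U"
    proof (cases "C = {}")
      case True
      then show ?thesis using I M(1) by blast
    next
      case False
      have CA: "J \<in> ?\<A>" if "J \<in> C" for J using C that by (auto simp: subset.chain_def)
      have "ideal (\<Union>C)"
        unfolding ideal_def
      proof (intro conjI ballI allI)
        show "0 \<in> \<Union>C" using False CA idealD(1) by blast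
        fix a assume a: "a \<in> \<Union>C"
        then show "r * a \<in> \<Union>C" for r using CA idealD(3) by blast
        fix b assume "b \<in> \<Union>C"
        with a obtain A B where AB: "A \<in> C" "B \<in> C" "a \<in> A" "b \<in> B" by blast
        then have "A \<subseteq> B \<or> B \<subseteq> A" using C by (auto simp: subset_chain_def)
        then show "a + b \<in> \<Union>C" using AB CA idealD(2) by blast
      qed
      then have "\<Union>C \<in> ?\<A>" using CA False by blast
      moreover have "\<forall>X\<in>C. X \<subseteq> \<Union>C" by blast
      ultimately show ?thesis by (rule bexI[rotated])
    qed
  qed
  then obtain J where JA: "J \<in> ?\<A>" and mx: "\<forall>J'\<in>?\<A>. J \<subseteq> J' \<longrightarrow> J' = J" ..
  have J: "ideal J" "I \<subseteq> J" "M \<inter> J = {}" using JA by simp_all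
  have max: "J' = J" if "ideal J'" "I \<subseteq> J'" "M \<inter> J' = {}" "J \<subseteq> J'" for J'
    using mx that by simp
  have ex: "\<exists>m\<in>M. \<exists>r. m - r * a \<in> J" if a: "a \<notin> J" for a
  proof -
    \<comment> \<open>The ideal generated by \<open>J\<close> and \<open>a\<close>.\<close>
    let ?J' = "{x. \<exists>r. x - r * a \<in> J}"
    have "ideal ?J'"
      unfolding ideal_def
    proof (intro conjI ballI allI)
      show "0 \<in> ?J'" using idealD(1)[OF J(1)] by (auto intro: exI[of _ 0])
      fix x assume "x \<in> ?J'"
      then obtain r where r: "x - r * a \<in> J" by blast
      have "s * x - (s * r) * a \<in> J" for s
        using idealD(3)[OF J(1) r, of s] by (simp add: algebra_simps)
      then show "s * x \<in> ?J'" for s by blast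
      fix y assume "y \<in> ?J'"
      then obtain s where s: "y - s * a \<in> J" by blast
      have "x + y - (r + s) * a \<in> J"
        using idealD(2)[OF J(1) r s] by (simp add: algebra_simps)
      then show "x + y \<in> ?J'" by blast
    qed
    moreover have "J \<subseteq> ?J'" by (auto intro: exI[of _ 0])
    moreover have "a \<in> ?J'" using idealD(1)[OF J(1)] by (auto intro: exI[of _ 1])
    ultimately have "M \<inter> ?J' \<noteq> {}" using max[of ?J'] a J(2) by blast
    then show ?thesis by blast
  qed
  have "a \<in> J \<or> b \<in> J" if ab: "a * b \<in> J" for a b
  proof (rule ccontr)
    assume "\<not> ?thesis"
    then obtain m r m' s where m: "m \<in> M" "m - r * a \<in> J" "m' \<in> M" "m' - s * b \<in> J"
      using ex by (metis (no_types))
    have "m * m' = (m - r * a) * m' + (m' - s * b) * (r * a) + (r * s) * (a * b)"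
      by (simp add: algebra_simps)
    then have "m * m' \<in> J" using m ab idealD[OF J(1)] by metis
    then show False using M(3) m J(3) by blast
  qed
  then show ?thesis using that J ex by blast
qed

section \<open>Univariate polynomials evaluated at an element of the polynomial ring\<close>

definition upoly :: "'v cpoly \<Rightarrow> complex poly \<Rightarrow> 'v cpoly" where
  "upoly x P = poly (map_poly const P) x"

lemma upoly_pCons: "upoly x (pCons c P) = const c + x * upoly x P"
  by (simp add: upoly_def map_poly_pCons)

lemma upoly_0 [simp]: "upoly x 0 = 0"
  by (simp add: upoly_def)

lemma upoly_add: "upoly x (P + Q) = upoly x P + upoly x Q"
  by (induction P Q rule: poly_induct2) (simp_all add: upoly_pCons const_add algebra_simps)

lemma upoly_smult: "upoly x (smult c P) = const c * upoly x P"
  by (induction P) (simp_all add: upoly_pCons const_mult algebra_simps)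

lemma upoly_mult: "upoly x (P * Q) = upoly x P * upoly x Q"
  by (induction P) (simp_all add: upoly_pCons upoly_add upoly_smult algebra_simps)

lemma upoly_sum: "upoly x (sum f A) = (\<Sum>a\<in>A. upoly x (f a))"
  by (induction A rule: infinite_finite_induct) (simp_all add: upoly_add)

lemma upoly_prod: "upoly x (prod f A) = (\<Prod>a\<in>A. upoly x (f a))"
proof -
  have "upoly x 1 = 1" by (simp add: one_pCons upoly_pCons)
  then show ?thesis by (induction A rule: infinite_finite_induct) (simp_all add: upoly_mult)
qed

lemma const_minus: "const (- c) = - const c"
  by (simp add: const_def single_uminus)

text \<open>Over the complex numbers \<open>P\<close> splits, and primality puts one of its linear
  factors, evaluated at \<open>x\<close>, into \<open>J\<close>; a nonzero constant in
  \<open>J\<close> would contradict \<open>1 \<notin> J\<close>.\<close>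

lemma upoly_in_prime_ideal:
  assumes J: "ideal J" "1 \<notin> J" "\<And>a b. a * b \<in> J \<Longrightarrow> a \<in> J \<or> b \<in> J"
    and "upoly x P \<in> J" "P \<noteq> 0"
  shows "\<exists>c. x - const c \<in> J"
  using assms(4,5)
proof (induction "degree P" arbitrary: P rule: less_induct)
  case less
  show ?case
  proof (cases "degree P = 0")
    case True
    then obtain c where c: "P = [:c:]" by (rule degree_eq_zeroE)
    with less.prems(2) have "c \<noteq> 0" by auto
    have "const (1 / c) * upoly x P = 1"
      using c \<open>c \<noteq> 0\<close> by (simp add: upoly_pCons const_mult[symmetric])
    then show ?thesis using idealD(3)[OF J(1) less.prems(1)] J(2) by metis
  next
    case False
    then have "\<not> constant (poly P)" by (simp add: constant_degree)
    then obtain z where "poly P z = 0" using fundamental_theorem_of_algebra by blast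
    then obtain Q where Q: "P = [:- z, 1:] * Q" by (auto simp: poly_eq_0_iff_dvd)
    with less.prems have "Q \<noteq> 0" by auto
    then have deg: "degree Q < degree P" unfolding Q by (subst degree_mult_eq) auto
    have "upoly x P = (x - const z) * upoly x Q"
      unfolding Q upoly_mult by (simp add: upoly_pCons const_minus)
    then have "x - const z \<in> J \<or> upoly x Q \<in> J" using J(3) less.prems(1) by metis
    then show ?thesis using less.hyps[OF deg _ \<open>Q \<noteq> 0\<close>] by blast
  qed
qed

text \<open>Provides span and linear dependence for the cofactors in
  \<open>coordinate_in_ideal\<close>.\<close>

interpretation cpoly_vs: vector_space "\<lambda>c (p :: 'v cpoly). const c * p"
  by unfold_locales (simp_all add: const_add const_mult algebra_simps)

text \<open>A combination of Lagrange basis polynomials: at the node \<open>c\<close> only the term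
  of index \<open>c\<close> survives.\<close>

lemma upoly_lagrange_nonzero:
  fixes a :: "complex \<Rightarrow> complex"
  assumes "finite T" "c \<in> T" "a c \<noteq> 0"
  shows "(\<Sum>c\<in>T. smult (a c) (\<Prod>e\<in>T - {c}. [:- e, 1:])) \<noteq> 0"
proof
  assume "(\<Sum>c\<in>T. smult (a c) (\<Prod>e\<in>T - {c}. [:- e, 1:])) = 0"
  then have "0 = (\<Sum>b\<in>T. a b * (\<Prod>e\<in>T - {b}. c - e))"
    by (drule_tac arg_cong[where f="\<lambda>p. poly p c"]) (simp add: poly_sum poly_prod)
  also have "\<dots> = (\<Sum>b\<in>T. if b = c then a c * (\<Prod>e\<in>T - {c}. c - e) else 0)"
    using assms(1,2) by (intro sum.cong refl) auto
  also have "\<dots> = a c * (\<Prod>e\<in>T - {c}. c - e)" using assms(1,2) by simp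
  finally show False using assms by auto
qed

text \<open>
  If no \<open>x - c\<close> lay in \<open>J\<close>, then modulo \<open>J\<close> every \<open>x - c\<close> would divide some element of the
  countable set \<open>M\<close>.  Uncountably many of the cofactors share this element and their finite set of
  monomials, so they are linearly dependent; clearing denominators gives an equation for \<open>x\<close>.
\<close>

lemma coordinate_in_ideal:
  fixes J :: "'n::finite cpoly set"
  assumes J: "ideal J" "M \<inter> J = {}" "1 \<in> M" "countable M"
    "\<And>a b. a * b \<in> J \<Longrightarrow> a \<in> J \<or> b \<in> J"
    "\<And>a. a \<notin> J \<Longrightarrow> \<exists>m\<in>M. \<exists>r. m - r * a \<in> J"
  shows "\<exists>c. x - const c \<in> J"
proof (rule ccontr)
  assume none: "\<nexists>c. x - const c \<in> J"
  then have "\<forall>c. \<exists>m r. m \<in> M \<and> m - r * (x - const c) \<in> J" using J(6) by blast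
  then obtain m g where mg: "\<And>c. m c \<in> M" "\<And>c. m c - g c * (x - const c) \<in> J" by metis
  have cm: "countable (UNIV :: ('n \<Rightarrow>\<^sub>0 nat) set)"
  proof (rule countableI')
    have "inj (Poly_Mapping.lookup :: ('n \<Rightarrow>\<^sub>0 nat) \<Rightarrow> _)"
      by (auto intro!: injI poly_mapping_eqI)
    then show "inj (to_nat \<circ> (Poly_Mapping.lookup :: ('n \<Rightarrow>\<^sub>0 nat) \<Rightarrow> _))"
      by (intro inj_compose) auto
  qed
  let ?h = "\<lambda>c. (m c, Poly_Mapping.keys (g c))"
  have "countable {E :: ('n \<Rightarrow>\<^sub>0 nat) set. finite E \<and> E \<subseteq> UNIV}"
    using countable_Collect_finite_subset[OF cm] by (simp add: conj_commute)
  then have "countable (M \<times> {E :: ('n \<Rightarrow>\<^sub>0 nat) set. finite E})" using J(4) by simp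
  moreover have "range ?h \<subseteq> M \<times> {E. finite E}" using mg(1) by auto
  ultimately have "countable (range ?h)" using countable_subset by blast
  moreover have "uncountable (UNIV :: complex set)" by (rule uncountable_UNIV_complex)
  moreover have "(\<Union>y\<in>range ?h. ?h -` {y}) = UNIV" by blast
  ultimately obtain y where y: "uncountable (?h -` {y})"
    using countable_UN[of "range ?h" "\<lambda>y. ?h -` {y}"] by metis
  let ?C = "?h -` {y}"
  have inf: "infinite ?C" using y countable_finite by blast
  obtain m0 E where y_eq: "y = (m0, E)" by (cases y)
  have C: "m c = m0" "Poly_Mapping.keys (g c) = E" if "c \<in> ?C" for c
    using that by (auto simp: y_eq)
  obtain c1 where c1: "c1 \<in> ?C" using infinite_imp_nonempty[OF inf] by blast
  have m0: "m0 \<in> M" using C(1)[OF c1] mg(1)[of c1] by simp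
  \<comment> \<open>If \<open>g\<close> repeats a value on \<open>?C\<close>, two equal cofactors
    give the relation. Otherwise its infinitely many values lie in the finite-dimensional span of
    the monomials in \<open>E\<close>.\<close>
  have "\<exists>T a. finite T \<and> T \<subseteq> ?C \<and> (\<exists>c\<in>T. a c \<noteq> 0) \<and> (\<Sum>c\<in>T. const (a c) * g c) = 0"
  proof (cases "inj_on g ?C")
    case True
    let ?B = "(\<lambda>e. Poly_Mapping.single e (1::complex)) ` E"
    have finE: "finite E" using C(2)[OF c1] finite_keys[of "g c1"] by simp
    have "g ` ?C \<subseteq> cpoly_vs.span ?B"
    proof (rule image_subsetI)
      fix c assume c: "c \<in> ?C"
      have "g c = (\<Sum>e\<in>E. const (Poly_Mapping.lookup (g c) e) * Poly_Mapping.single e 1)"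
        by (subst cpoly_eq_sum_single[of "g c"]) (simp add: C(2)[OF c] const_def mult_single)
      also have "\<dots> \<in> cpoly_vs.span ?B"
        by (intro cpoly_vs.span_sum cpoly_vs.span_scale cpoly_vs.span_base) auto
      finally show "g c \<in> cpoly_vs.span ?B" .
    qed
    moreover have "infinite (g ` ?C)" using True inf by (simp add: finite_image_iff)
    ultimately have "cpoly_vs.dependent (g ` ?C)"
      using cpoly_vs.independent_span_bound[of ?B "g ` ?C"] finE by blast
    then obtain t u where t: "finite t" "t \<subseteq> g ` ?C" "(\<Sum>v\<in>t. const (u v) * v) = 0" "\<exists>v\<in>t. u v \<noteq> 0"
      unfolding cpoly_vs.dependent_explicit by blast
    obtain T where T: "T \<subseteq> ?C" "t = g ` T" using t(2) by (meson subset_imageE)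
    have injT: "inj_on g T" using True T(1) inj_on_subset by blast
    have "finite T" using t(1) T(2) injT finite_image_iff by blast
    moreover have "(\<Sum>c\<in>T. const (u (g c)) * g c) = 0"
      using t(3) by (simp add: T(2) sum.reindex[OF injT])
    moreover have "\<exists>c\<in>T. u (g c) \<noteq> 0" using t(4) T(2) by blast
    ultimately show ?thesis using T(1) by (intro exI[of _ T] exI[of _ "\<lambda>c. u (g c)"]) simp
  next
    case False
    then obtain c e where ce: "c \<in> ?C" "e \<in> ?C" "c \<noteq> e" "g c = g e" unfolding inj_on_def by blast
    let ?a = "\<lambda>z. if z = c then 1 else - 1 :: complex"
    have "(\<Sum>z\<in>{c, e}. const (?a z) * g z) = 0"
      using ce by (simp add: const_minus)
    then show ?thesis using ce by (intro exI[of _ "{c, e}"] exI[of _ ?a]) auto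
  qed
  then obtain T a c0 where T: "finite T" "T \<subseteq> ?C" "c0 \<in> T" "a c0 \<noteq> 0"
    and rel: "(\<Sum>c\<in>T. const (a c) * g c) = 0" by blast
  \<comment> \<open>Modulo \<open>J\<close>, \<open>m0 * Q c\<close> equals \<open>g c\<close> times
    the full product over \<open>T\<close>. In the sum weighted by \<open>a\<close> the cofactors
    cancel by \<open>rel\<close>, leaving \<open>m0\<close> times a nonzero univariate polynomial
    evaluated at \<open>x\<close>.\<close>
  define Q where "Q c = (\<Prod>e\<in>T - {c}. x - const e)" for c
  have "const (a c) * (m0 * Q c) - const (a c) * g c * (\<Prod>e\<in>T. x - const e) \<in> J" if "c \<in> T" for c
  proof -
    have P: "(\<Prod>e\<in>T. x - const e) = (x - const c) * Q c"
      unfolding Q_def using T(1) that by (simp add: prod.remove)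
    have "const (a c) * (m0 * Q c) - const (a c) * g c * (\<Prod>e\<in>T. x - const e) =
        (const (a c) * Q c) * (m0 - g c * (x - const c))"
      unfolding P by (simp add: algebra_simps)
    moreover have "m0 - g c * (x - const c) \<in> J" using mg(2)[of c] C(1)[of c] that T(2) by auto
    ultimately show ?thesis using idealD(3)[OF J(1)] by metis
  qed
  then have "(\<Sum>c\<in>T. const (a c) * (m0 * Q c) - const (a c) * g c * (\<Prod>e\<in>T. x - const e)) \<in> J"
    by (rule ideal_sum[OF J(1)])
  also have "(\<Sum>c\<in>T. const (a c) * (m0 * Q c) - const (a c) * g c * (\<Prod>e\<in>T. x - const e)) =
      m0 * (\<Sum>c\<in>T. const (a c) * Q c) - (\<Sum>c\<in>T. const (a c) * g c) * (\<Prod>e\<in>T. x - const e)"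
    by (simp add: sum_subtractf sum_distrib_left sum_distrib_right mult_ac)
  also have "\<dots> = m0 * upoly x (\<Sum>c\<in>T. smult (a c) (\<Prod>e\<in>T - {c}. [:- e, 1:]))"
    unfolding rel by (simp add: upoly_sum upoly_smult upoly_prod upoly_pCons const_minus Q_def)
  finally have "upoly x (\<Sum>c\<in>T. smult (a c) (\<Prod>e\<in>T - {c}. [:- e, 1:])) \<in> J"
    using J(2,5) m0 by blast
  then have "\<exists>c. x - const c \<in> J"
    using upoly_in_prime_ideal[OF J(1) _ J(5)] J(2,3) upoly_lagrange_nonzero[OF T(1,3), of a] T(4)
    by blast
  then show False using none by blast
qed

text \<open>A prime ideal \<open>J\<close> as in \<open>ideal_avoiding_maximal\<close> has all
  coordinates constant modulo \<open>J\<close> by \<open>coordinate_in_ideal\<close>, so it is the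
  ideal of a point.\<close>

lemma countable_nullstellensatz:
  fixes I :: "'n::finite cpoly set"
  assumes I: "ideal I" and M: "M \<inter> I = {}" "1 \<in> M" "countable M"
    "\<And>a b. a \<in> M \<Longrightarrow> b \<in> M \<Longrightarrow> a * b \<in> M"
  obtains x where "\<And>f. f \<in> I \<Longrightarrow> peval f x = 0" "\<And>f. f \<in> M \<Longrightarrow> peval f x \<noteq> 0"
proof -
  obtain J where J: "ideal J" "I \<subseteq> J" "M \<inter> J = {}"
    "\<And>a b. a * b \<in> J \<Longrightarrow> a \<in> J \<or> b \<in> J"
    "\<And>a. a \<notin> J \<Longrightarrow> \<exists>m\<in>M. \<exists>r. m - r * a \<in> J"
    using ideal_avoiding_maximal[OF I M(1,2,4)] by blast
  have "\<forall>i. \<exists>c. Var i - const c \<in> J"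
    using coordinate_in_ideal[OF J(1,3) M(2,3) J(4,5)] by blast
  then obtain x where x: "\<And>i. Var i - const (x i) \<in> J" by metis
  \<comment> \<open>Congruence of the coordinates with constants carries over to every polynomial
    and its value.\<close>
  have diff: "f - const (peval f x) \<in> J" for f
  proof -
    have prod: "prod u A - prod v A \<in> J" if "\<And>i. i \<in> A \<Longrightarrow> u i - v i \<in> J"
      for u v :: "'n \<Rightarrow> 'n cpoly" and A
      using that
    proof (induction A rule: infinite_finite_induct)
      case (insert i A)
      have "prod u (insert i A) - prod v (insert i A) =
          u i * (prod u A - prod v A) + prod v A * (u i - v i)"
        using insert.hyps by (simp add: algebra_simps)
      then show ?case using insert idealD[OF J(1)] by (metis insertCI)
    qed (use idealD(1)[OF J(1)] in auto)
    have pow: "u ^ n - v ^ n \<in> J" if "u - v \<in> J" for u v :: "'n cpoly" and n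
    proof (induction n)
      case (Suc n)
      have "u ^ Suc n - v ^ Suc n = u * (u ^ n - v ^ n) + v ^ n * (u - v)"
        by (simp add: algebra_simps)
      then show ?case using Suc that idealD[OF J(1)] by metis
    qed (use idealD(1)[OF J(1)] in auto)
    have "psubst f Var - psubst f (\<lambda>i. const (x i)) \<in> J"
      unfolding psubst_def sum_subtractf[symmetric] right_diff_distrib[symmetric]
      by (intro ideal_sum[OF J(1)] idealD(3)[OF J(1)] prod pow x)
    moreover have "psubst f Var = f" by (rule cpoly_eqI) (simp add: peval_psubst)
    moreover have "psubst f (\<lambda>i. const (x i)) = (const (peval f x) :: 'n cpoly)"
      by (rule cpoly_eqI) (simp add: peval_psubst)
    ultimately show ?thesis by simp
  qed
  show ?thesis
  proof (rule that[of x])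
    fix f assume "f \<in> I"
    then have "const (peval f x) \<in> J"
      using idealD(5)[OF J(1) _ diff[of f], of f] J(2) by auto
    then have "const (1 / peval f x) * const (peval f x) \<in> J" using idealD(3)[OF J(1)] by blast
    moreover have "1 \<notin> J" using J(3) M(2) by blast
    moreover have "const (1 / peval f x) * const (peval f x) = (1 :: 'n cpoly)" if "peval f x \<noteq> 0"
      using that by (simp flip: const_mult)
    ultimately show "peval f x = 0" by metis
  next
    fix f assume f: "f \<in> M"
    show "peval f x \<noteq> 0"
    proof
      assume "peval f x = 0"
      then have "f \<in> J" using diff[of f] by simp
      then show False using f J(3) by blast
    qed
  qed
qed

section \<open>The star locus\<close>

text \<open>
  The kernel of the differential at a smooth point is spanned by the vectors
  \<open>\<partial>\<^sub>iF(p) z - dF(p)(z) e\<^sub>i\<close>, so the condition defining star points is polynomial in \<open>p\<close>.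
\<close>

definition starpoly :: "'n::finite cpoly \<Rightarrow> 'n \<Rightarrow> complex ^ 'n \<Rightarrow> 'n cpoly" where
  "starpoly F i z = (\<Sum>k\<in>UNIV. psubst (partial_deriv k F)
     (\<lambda>j. const (z $ j) * partial_deriv i F -
       (if j = i then \<Sum>m\<in>UNIV. const (z $ m) * partial_deriv m F else 0)) * Var k)"

lemma ev_starpoly:
  "ev (starpoly F i z) p =
    dotp (grad F (grad F p $ i *s z - dotp (grad F p) z *s axis i 1)) p"
proof -
  have "(\<lambda>j. peval (const (z $ j) * partial_deriv i F -
       (if j = i then \<Sum>m\<in>UNIV. const (z $ m) * partial_deriv m F else 0)) (($) p)) =
     ($) (grad F p $ i *s z - dotp (grad F p) z *s axis i 1)"
    by (auto simp: fun_eq_iff peval_minus peval_mult peval_sum grad_def dotp_def axis_def mult.commute)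
  then show ?thesis
    by (simp add: starpoly_def peval_sum peval_mult peval_psubst) (simp add: dotp_def grad_def)
qed

text \<open>If the \<open>i\<close>-th derivative at \<open>v\<close> is nonzero, any
  \<open>y\<close> in the kernel is the vector at which \<open>ev_starpoly\<close> takes the
  gradient, for \<open>z = y / grad F v $ i\<close>.\<close>

lemma is_star_if_starpoly:
  assumes hom: "homogeneous d F" and "ev F v = 0" "grad F v \<noteq> 0"
    and star: "\<And>i z. ev (starpoly F i z) v = 0"
  shows "is_star F v"
proof -
  obtain i where i: "grad F v $ i \<noteq> 0" using assms(3) by (auto simp: vec_eq_iff)
  have "dotp (grad F y) v = 0" if "y \<in> kerd (grad F v)" for y
  proof -
    have y: "dotp (grad F v) y = 0" using that by (simp add: kerd_def)
    have "grad F v $ i *s ((1 / grad F v $ i) *s y) -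
        dotp (grad F v) ((1 / grad F v $ i) *s y) *s axis i 1 = y"
      using i y by (simp add: dotp_simps)
    then show ?thesis using star[of i "(1 / grad F v $ i) *s y"] by (simp only: ev_starpoly)
  qed
  moreover have "v \<in> kerd (grad F v)"
    using grad_dotp_self[OF hom, of v] assms(2) by (simp add: kerd_def)
  ultimately show ?thesis using assms(3) by (simp add: is_star_def vtx_def)
qed

lemma grad_0:
  assumes "homogeneous d F" "d \<ge> 2"
  shows "grad F 0 = 0"
  using grad_scale[OF assms(1), of 0 0] assms(2) by (simp add: power_0_left)

text \<open>At singular vectors the gradient is taken at 0, where it vanishes as
  \<open>d \<ge> 2\<close>. So the equations hold on the whole vertex space, not only at its star
  vectors.\<close>

lemma ev_starpoly_vtx:
  assumes hom: "homogeneous d F" and "d \<ge> 2" "a \<noteq> 0" and w: "w \<in> vtx F (kerd a)"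
  shows "ev (starpoly F i z) w = 0"
proof (cases "grad F w = 0")
  case True
  then show ?thesis by (simp add: ev_starpoly grad_0[OF assms(1,2)] dotp_simps)
next
  case False
  have "is_star F w" by (rule vtx_star[OF hom assms(2,3) w False])
  moreover have "grad F w $ i *s z - dotp (grad F w) z *s axis i 1 \<in> kerd (grad F w)"
    by (simp add: kerd_def dotp_simps dotp_axis)
  ultimately show ?thesis by (simp add: ev_starpoly is_star_def vtx_def)
qed

text \<open>The vertex space is the common kernel of \<open>a\<close> and the differentials at the
  vectors of \<open>kerd a\<close>; one of these forms detects \<open>x\<close>.\<close>

lemma vtx_separating_form:
  assumes "x \<notin> vtx F (kerd a)"
  obtains c where "vtx F (kerd a) \<subseteq> kerd c" "dotp c x \<noteq> 0"
proof (cases "x \<in> kerd a")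
  case True
  then obtain z where "z \<in> kerd a" "dotp (grad F z) x \<noteq> 0" using assms by (auto simp: vtx_def)
  then show ?thesis using that[of "grad F z"] by (auto simp: vtx_def kerd_def)
next
  case False
  then show ?thesis using that[of a] by (auto simp: vtx_def kerd_def)
qed

text \<open>Equations that hold on almost all vertex spaces of a suitable infinite family, together
  with countably many inequations, are solved by a vector \<open>v\<close>. The equations make
  \<open>v\<close> a star vector, while the inequations make it smooth and exclude it from every
  vertex space, including its own.\<close>

lemma finite_star_hyperplanes:
  fixes F :: "'n::finite cpoly"
  assumes hom: "homogeneous d F" and d: "d \<ge> 3"
  shows "finite {kerd (grad F p) | p. is_star F p}"
proof (rule ccontr)
  define H where "H = {kerd (grad F p) | p. is_star F p}"
  assume "infinite {kerd (grad F p) | p. is_star F p}"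
  then have inf: "infinite H" by (simp add: H_def)
  let ?W = "vtx F"
  have d2: "d \<ge> 2" using d by simp
  have HE: "\<exists>p. K = kerd (grad F p) \<and> is_star F p" if "K \<in> H" for K
    using that by (auto simp: H_def)
  have subW: "vec.subspace (?W K)" if "K \<in> H" for K
    using HE[OF that] subspace_vtx subspace_kerd by blast
  \<comment> \<open>A star vector of \<open>K\<close> inside \<open>?W K'\<close> is smooth, so its
    tangent hyperplane is both \<open>K\<close> and \<open>K'\<close>.\<close>
  have inj: "K = K'" if KK: "K \<in> H" "K' \<in> H" "?W K \<subseteq> ?W K'" for K K'
  proof -
    obtain p p' where p: "K = kerd (grad F p)" "is_star F p" "K' = kerd (grad F p')" "is_star F p'"
      using HE[OF KK(1)] HE[OF KK(2)] by blast
    then have "p \<in> ?W (kerd (grad F p'))" "grad F p \<noteq> 0" "grad F p' \<noteq> 0"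
      using KK(3) by (auto simp: is_star_def)
    from vtx_star(1)[OF hom d2 this(3,1,2)] show ?thesis using p by simp
  qed
  \<comment> \<open>Finitely many derivatives cover \<open>H\<close>, so one \<open>i\<close> serves
    infinitely many hyperplanes; its derivative will be the inequation that enforces
    smoothness.\<close>
  define Q where "Q i K \<longleftrightarrow> (\<exists>p\<in>?W K. ev (partial_deriv i F) p \<noteq> 0)" for i K
  have "H = (\<Union>i\<in>UNIV. {K \<in> H. Q i K})"
  proof -
    have "\<exists>i. Q i K" if "K \<in> H" for K
    proof -
      obtain p where p: "K = kerd (grad F p)" "is_star F p" using HE \<open>K \<in> H\<close> by blast
      then obtain i where "grad F p $ i \<noteq> 0" by (auto simp: is_star_def vec_eq_iff)
      then show ?thesis using p by (auto simp: Q_def is_star_def grad_def)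
    qed
    then show ?thesis by blast
  qed
  moreover have "finite (\<Union>i\<in>UNIV. {K \<in> H. Q i K})" if "\<nexists>i. infinite {K \<in> H. Q i K}"
    using that by (intro finite_UN_I) auto
  ultimately obtain i where i: "infinite {K \<in> H. Q i K}" using inf by auto
  txt \<open>Minimality of the span makes every linear form that vanishes on infinitely many of the
    spaces indexed by \<open>A\<close> vanish on all of them.\<close>
  define P where "P A \<longleftrightarrow> infinite A \<and> A \<subseteq> {K \<in> H. Q i K}" for A
  define T where "T A = vec.span (\<Union>K\<in>A. ?W K)" for A
  have "P {K \<in> H. Q i K}" using i by (simp add: P_def)
  then obtain A where A: "P A" and min: "\<And>B. P B \<Longrightarrow> vec.dim (T A) \<le> vec.dim (T B)"
    using ex_has_least_nat[of P _ "\<lambda>A. vec.dim (T A)"] by metis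
  have AH: "A \<subseteq> H" and infA: "infinite A" using A by (auto simp: P_def)
  have TB: "T B = T A" if "infinite B" "B \<subseteq> A" for B
  proof -
    have "T B \<subseteq> T A" unfolding T_def using that(2) by (intro vec.span_mono) blast
    moreover have "P B" using that A by (auto simp: P_def)
    ultimately show ?thesis
      using vec.subspace_dim_equal[of "T B" "T A"] min by (simp add: T_def)
  qed
  have fin_form: "finite {K \<in> A. \<forall>w\<in>?W K. ev (linform c) w = 0}"
    if c: "dotp c x \<noteq> 0" "x \<in> T A" for c x
  proof (rule ccontr)
    let ?B = "{K \<in> A. \<forall>w\<in>?W K. ev (linform c) w = 0}"
    assume "infinite ?B"
    then have "x \<in> T ?B" using TB[of ?B] c(2) by blast
    moreover have "T ?B \<subseteq> kerd c"
      unfolding T_def by (intro vec.span_minimal subspace_kerd) (auto simp: ev_linform kerd_def)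
    ultimately show False using c(1) by (auto simp: kerd_def)
  qed
  \<comment> \<open>The span \<open>T A\<close> fits into no single \<open>?W K\<close>, since
    \<open>inj\<close> would then reduce \<open>A\<close> to one element. So each
    \<open>?W K\<close> lies in the kernel of a form that is nonzero on \<open>T A\<close>, to which
    \<open>fin_form\<close> applies.\<close>
  have "\<exists>c x. ?W K \<subseteq> kerd c \<and> dotp c x \<noteq> 0 \<and> x \<in> T A" if K: "K \<in> H" for K
  proof -
    have "\<not> T A \<subseteq> ?W K"
    proof
      assume "T A \<subseteq> ?W K"
      then have "K' = K" if "K' \<in> A" for K'
        using inj[of K' K] that K AH vec.span_superset unfolding T_def by blast
      then have "A \<subseteq> {K}" by blast
      then show False using infA finite_subset by blast
    qed
    then obtain x where "x \<in> T A" "x \<notin> ?W K" by blast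
    moreover obtain a where "K = kerd a" using HE[OF K] by blast
    ultimately show ?thesis using vtx_separating_form[of x F a] by metis
  qed
  then obtain c x where c: "\<And>K. K \<in> H \<Longrightarrow> ?W K \<subseteq> kerd (c K)"
    "\<And>K. K \<in> H \<Longrightarrow> dotp (c K) (x K) \<noteq> 0" "\<And>K. K \<in> H \<Longrightarrow> x K \<in> T A" by metis
  \<comment> \<open>\<open>G\<close> collects the inequations: smoothness, and one form per
    hyperplane in \<open>H\<close> that keeps the point out of its vertex space. \<open>M\<close> is
    the set of their finite products, and \<open>I\<close> consists of the polynomials that vanish
    on \<open>?W K\<close> for all but finitely many \<open>K\<close> in \<open>A\<close>.\<close>
  define G where "G = insert (partial_deriv i F) ((\<lambda>K. linform (c K)) ` H)"
  define M where "M = prod_list ` lists G"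
  define I where "I = {f. finite {K \<in> A. \<exists>w\<in>?W K. ev f w \<noteq> 0}}"
  have finG: "finite {K \<in> A. \<forall>w\<in>?W K. ev f w = 0}" if "f \<in> G" for f
  proof (cases "f = partial_deriv i F")
    case True
    then have "{K \<in> A. \<forall>w\<in>?W K. ev f w = 0} = {}" using A by (auto simp: P_def Q_def)
    then show ?thesis by (simp only: finite.emptyI)
  next
    case False
    then show ?thesis using that c(2,3) fin_form by (auto simp: G_def)
  qed
  \<comment> \<open>Each \<open>?W K\<close> is irreducible, so a product vanishes on it only if one
    of its factors does.\<close>
  have finM: "finite {K \<in> A. \<forall>w\<in>?W K. ev (prod_list xs) w = 0}" if "xs \<in> lists G" for xs
    using that
  proof (induction xs)
    case Nil
    have "{K \<in> A. \<forall>w\<in>?W K. ev (prod_list []) w = 0} = {}"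
      using AH subW vec.subspace_0 by fastforce
    then show ?case by (simp only: finite.emptyI)
  next
    case (Cons f xs)
    have "{K \<in> A. \<forall>w\<in>?W K. ev (prod_list (f # xs)) w = 0} \<subseteq>
        {K \<in> A. \<forall>w\<in>?W K. ev f w = 0} \<union> {K \<in> A. \<forall>w\<in>?W K. ev (prod_list xs) w = 0}"
    proof
      fix K assume K: "K \<in> {K \<in> A. \<forall>w\<in>?W K. ev (prod_list (f # xs)) w = 0}"
      then have "(\<forall>w\<in>?W K. ev f w = 0) \<or> (\<forall>w\<in>?W K. ev (prod_list xs) w = 0)"
        using AH by (intro ev_product_zero_on_subspace subW) (auto simp: peval_mult)
      then show "K \<in> {K \<in> A. \<forall>w\<in>?W K. ev f w = 0} \<union> {K \<in> A. \<forall>w\<in>?W K. ev (prod_list xs) w = 0}"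
        using K by blast
    qed
    then show ?case using finG[of f] Cons by (meson finite_UnI finite_subset)
  qed
  have "ideal I"
    unfolding ideal_def
  proof (intro conjI ballI allI)
    show "0 \<in> I" by (simp add: I_def)
    fix f assume f: "f \<in> I"
    show "r * f \<in> I" for r
      using f unfolding I_def by (auto elim!: rev_finite_subset simp: peval_mult)
    fix g assume g: "g \<in> I"
    have "{K \<in> A. \<exists>w\<in>?W K. ev (f + g) w \<noteq> 0} \<subseteq>
       {K \<in> A. \<exists>w\<in>?W K. ev f w \<noteq> 0} \<union> {K \<in> A. \<exists>w\<in>?W K. ev g w \<noteq> 0}"
      by (auto simp: peval_add)
    then show "f + g \<in> I" using f g unfolding I_def by (simp add: finite_subset)
  qed
  \<comment> \<open>A common element would split \<open>A\<close> into two finite parts, according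
    to whether it vanishes on \<open>?W K\<close>.\<close>
  moreover have "M \<inter> I = {}"
  proof (rule ccontr)
    assume "M \<inter> I \<noteq> {}"
    then obtain xs where xs: "xs \<in> lists G" "prod_list xs \<in> I" by (auto simp: M_def)
    have "finite {K \<in> A. \<exists>w\<in>?W K. ev (prod_list xs) w \<noteq> 0}"
      using xs(2) by (simp only: I_def mem_Collect_eq)
    from finite_UnI[OF finM[OF xs(1)] this] have "finite A" by (rule rev_finite_subset) blast
    then show False using infA by blast
  qed
  moreover have "1 \<in> M" unfolding M_def by (rule image_eqI[of _ _ "[]"]) auto
  moreover have "countable M"
    using countable_star_hyperplanes[OF hom d]
    unfolding M_def G_def H_def[symmetric] by (intro countable_image countable_lists) simp
  moreover have "a * b \<in> M" if ab: "a \<in> M" "b \<in> M" for a b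
  proof -
    obtain xs ys where "xs \<in> lists G" "ys \<in> lists G" "a = prod_list xs" "b = prod_list ys"
      using ab by (auto simp: M_def)
    then show ?thesis unfolding M_def by (intro image_eqI[of _ _ "xs @ ys"]) auto
  qed
  ultimately obtain y where y: "\<And>f. f \<in> I \<Longrightarrow> peval f y = 0" "\<And>f. f \<in> M \<Longrightarrow> peval f y \<noteq> 0"
    using countable_nullstellensatz[of I M] by blast
  define v where "v = (\<chi> j. y j)"
  have "($) v = y" by (simp add: v_def fun_eq_iff)
  then have v: "ev f v = peval f y" for f by simp
  have GM: "f \<in> M" if "f \<in> G" for f
    unfolding M_def by (rule image_eqI[of _ _ "[f]"]) (use that in auto)
  have "ev (partial_deriv i F) v \<noteq> 0" unfolding v by (intro y(2) GM) (simp add: G_def)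
  then have grad: "grad F v \<noteq> 0" by (auto simp: grad_def vec_eq_iff)
  \<comment> \<open>Polynomials vanishing on all spaces indexed by \<open>A\<close> belong to
    \<open>I\<close>. Applied to \<open>F\<close> and to the polynomials
    \<open>starpoly F j z\<close>, this makes \<open>v\<close> a star vector.\<close>
  have van: "ev f v = 0" if "\<And>K w. K \<in> A \<Longrightarrow> w \<in> ?W K \<Longrightarrow> ev f w = 0" for f
  proof -
    have "{K \<in> A. \<exists>w\<in>?W K. ev f w \<noteq> 0} = {}" using that by blast
    then have "f \<in> I" unfolding I_def by (simp only: mem_Collect_eq finite.emptyI)
    then show ?thesis by (simp add: v y(1))
  qed
  have "is_star F v"
  proof (rule is_star_if_starpoly[OF hom _ grad])
    have Aa: "\<exists>a. a \<noteq> 0 \<and> K = kerd a" if "K \<in> A" for K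
      using HE[of K] that AH by (auto simp: is_star_def)
    show "ev F v = 0"
      using Aa d by (intro van) (metis vtx_zero[OF subspace_kerd _ hom] gr0I not_numeral_le_zero)
    show "ev (starpoly F j z) v = 0" for j z
      using Aa by (intro van) (metis ev_starpoly_vtx[OF hom d2])
  qed
  \<comment> \<open>\<open>v\<close> lies in the vertex space of its own hyperplane, where the form
    \<open>c\<close> of that hyperplane vanishes, contrary to an inequation imposed on
    \<open>v\<close>.\<close>
  then have K: "kerd (grad F v) \<in> H" and "v \<in> ?W (kerd (grad F v))"
    by (auto simp: H_def is_star_def)
  then have "ev (linform (c (kerd (grad F v)))) v = 0"
    using c(1)[OF K] by (auto simp: ev_linform kerd_def)
  moreover have "ev (linform (c (kerd (grad F v)))) v \<noteq> 0"
    unfolding v by (intro y(2) GM) (use K in \<open>auto simp: G_def\<close>)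
  ultimately show False by blast
qed

section \<open>Irreducible components of the closure of the star locus\<close>

lemma irreducible_subset_finite_Union:
  assumes Z: "irreducible_subset T Z" and "finite \<C>" "\<And>C. C \<in> \<C> \<Longrightarrow> closedin T C" "Z \<subseteq> \<Union>\<C>"
  shows "\<exists>C\<in>\<C>. Z \<subseteq> C"
  using assms(2-4)
proof (induction \<C>)
  case empty
  then show ?case using Z by (auto simp: irreducible_subset_def)
next
  case (insert C \<C>)
  have "closedin T (\<Union>\<C>)" using insert by (intro closedin_Union) auto
  moreover have "closedin T C" "Z \<subseteq> C \<union> \<Union>\<C>" using insert by auto
  ultimately have "Z \<subseteq> C \<or> Z \<subseteq> \<Union>\<C>" using Z unfolding irreducible_subset_def by blast
  then show ?case using insert by blast
qed

lemma closedin_lines_vtx: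
  "closedin zariski {L \<in> proj_space. L \<subseteq> vtx F (kerd a)}"
proof -
  have "{L \<in> proj_space. L \<subseteq> vtx F (kerd a)} = proj_zeros (linform ` insert a (grad F ` kerd a))"
    by (auto simp: proj_zeros_def ev_linform vtx_def kerd_def subset_iff)
  moreover have "\<forall>f\<in>linform ` insert a (grad F ` kerd a). \<exists>d. homogeneous d f"
    using homogeneous_linform by blast
  ultimately show ?thesis unfolding closedin_zariski by metis
qed

lemma mem_proj_zeros_span:
  assumes "v \<noteq> 0" "\<forall>f\<in>S. \<exists>d. homogeneous d f"
  shows "vec.span {v} \<in> proj_zeros S \<longleftrightarrow> (\<forall>f\<in>S. ev f v = 0)"
  using span_singleton_in_proj_space[OF assms(1)] assms(2) vanishes_on_span_iff[of _ _ v]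
  unfolding proj_zeros_def by blast

text \<open>For each pair of equations of \<open>A\<close> and \<open>B\<close> the product vanishes
  on \<open>U\<close>, so \<open>ev_product_zero_on_subspace\<close> applies.\<close>

lemma irreducible_lines_subspace:
  fixes U :: "(complex ^ 'n::finite) set"
  assumes U: "vec.subspace U" and p: "p \<in> U" "p \<noteq> 0"
  shows "irreducible_subset zariski {L \<in> proj_space. L \<subseteq> U}"
  unfolding irreducible_subset_def
proof (intro conjI allI impI)
  let ?Z = "{L \<in> proj_space. L \<subseteq> U}"
  show "?Z \<subseteq> topspace zariski" by (auto simp: topspace_zariski)
  show "?Z \<noteq> {}"
    using span_singleton_in_proj_space[OF p(2)] p(1) U span_singleton_subset_iff by blast
  fix A B assume AB: "closedin zariski A \<and> closedin zariski B \<and> ?Z \<subseteq> A \<union> B"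
  then obtain S T where S: "\<forall>f\<in>S. \<exists>d. homogeneous d f" "A = proj_zeros S"
    and T: "\<forall>f\<in>T. \<exists>d. homogeneous d f" "B = proj_zeros T"
    unfolding closedin_zariski by blast
  have *: "ev f w * ev g w = 0" if "f \<in> S" "g \<in> T" "w \<in> U" "w \<noteq> 0" for f g w
  proof -
    have "vec.span {w} \<in> ?Z"
      using that U span_singleton_in_proj_space span_singleton_subset_iff by blast
    then have "vec.span {w} \<in> proj_zeros S \<or> vec.span {w} \<in> proj_zeros T" using AB S T by blast
    then show ?thesis using mem_proj_zeros_span[OF that(4)] S(1) T(1) that(1,2) by auto
  qed
  have **: "(\<forall>w\<in>U. ev f w = 0) \<or> (\<forall>w\<in>U. ev g w = 0)" if fg: "f \<in> S" "g \<in> T" for f g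
  proof (rule ev_product_zero_on_subspace[OF U])
    fix w assume w: "w \<in> U"
    show "ev f w * ev g w = 0"
    proof (cases "w = 0")
      case True
      \<comment> \<open>At the origin a form of positive degree vanishes and one of degree 0 keeps
        its value at \<open>p\<close>, so the product is 0 in every case.\<close>
      obtain m n where m: "homogeneous m f" "homogeneous n g" using S T fg by blast
      have "ev f 0 = 0 ^ m * ev f p" "ev g 0 = 0 ^ n * ev g p"
        using ev_scale[OF m(1), of 0 p] ev_scale[OF m(2), of 0 p] by simp_all
      then show ?thesis using *[OF fg p] True by auto
    qed (use * fg w in blast)
  qed
  have sub: "?Z \<subseteq> proj_zeros S'" if "\<And>f. f \<in> S' \<Longrightarrow> \<forall>w\<in>U. ev f w = 0" for S'
    using that unfolding proj_zeros_def by blast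
  show "?Z \<subseteq> A \<or> ?Z \<subseteq> B"
  proof (cases "\<forall>f\<in>S. \<forall>w\<in>U. ev f w = 0")
    case True
    then show ?thesis using sub[of S] S(2) by blast
  next
    case False
    then have "\<And>g. g \<in> T \<Longrightarrow> \<forall>w\<in>U. ev g w = 0" using ** by blast
    then show ?thesis using sub[of T] T(2) by blast
  qed
qed

text \<open>An equation \<open>f\<close> of the closure vanishes at the star vectors, among them all
  smooth vectors of \<open>?W\<close>. So \<open>f * partial_deriv i F\<close> vanishes on
  \<open>?W\<close>, and the second factor is nonzero at \<open>p\<close>.\<close>

lemma lines_vtx_subset_closure:
  fixes F :: "'n::finite cpoly"
  assumes hom: "homogeneous d F" and d: "d \<ge> 2" and irr: "irreducible F" and p: "is_star F p"
  shows "{L \<in> proj_space. L \<subseteq> vtx F (kerd (grad F p))} \<subseteq> zariski closure_of {P. star_point d F P}"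
proof
  let ?S = "{P. star_point d F P}" and ?W = "vtx F (kerd (grad F p))"
  fix L assume "L \<in> {L \<in> proj_space. L \<subseteq> ?W}"
  then have L: "L \<in> proj_space" "L \<subseteq> ?W" by auto
  obtain T where T: "\<forall>f\<in>T. \<exists>d. homogeneous d f" "zariski closure_of ?S = proj_zeros T"
    using closedin_closure_of[of zariski ?S] unfolding closedin_zariski by blast
  have "?S \<subseteq> topspace zariski"
    by (auto simp: topspace_zariski star_point_def smooth_point_def proj_zeros_def)
  then have S: "?S \<subseteq> proj_zeros T" using closure_of_subset T(2) by metis
  have gp: "grad F p \<noteq> 0" "p \<in> ?W" using p by (auto simp: is_star_def)
  then obtain i where i: "ev (partial_deriv i F) p \<noteq> 0" by (auto simp: vec_eq_iff grad_def)
  have "\<forall>w\<in>?W. ev f w = 0" if f: "f \<in> T" for f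
  proof -
    have "(\<forall>w\<in>?W. ev f w = 0) \<or> (\<forall>w\<in>?W. ev (partial_deriv i F) w = 0)"
    proof (rule ev_product_zero_on_subspace[OF subspace_vtx[OF subspace_kerd]])
      fix w assume w: "w \<in> ?W"
      show "ev f w * ev (partial_deriv i F) w = 0"
      proof (cases "ev (partial_deriv i F) w = 0")
        case False
        then have gw: "grad F w \<noteq> 0" by (auto simp: vec_eq_iff grad_def)
        then have "w \<noteq> 0" using grad_0[OF hom d] by auto
        moreover have "is_star F w" by (rule vtx_star[OF hom d gp(1) w gw])
        ultimately have "vec.span {w} \<in> ?S" using star_point_span[OF hom d irr] by blast
        then show ?thesis using S mem_proj_zeros_span[OF \<open>w \<noteq> 0\<close> T(1)] f by auto
      qed simp
    qed
    then show ?thesis using i gp(2) by blast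
  qed
  then show "L \<in> zariski closure_of ?S"
    unfolding T(2) proj_zeros_def using L by blast
qed

text \<open>The closure lies in a finite union of closed linear sets, so the component lies in one
  of them. That set is irreducible and contained in the closure, hence equal to the component by
  maximality.\<close>

lemma component_star_locus:
  fixes F :: "'n::finite cpoly"
  assumes hom: "homogeneous d F" and d: "d \<ge> 3" and irr: "irreducible F"
    and comp: "irreducible_component zariski (zariski closure_of {P. star_point d F P}) \<Lambda>"
  obtains p where "is_star F p" "\<Lambda> = {L \<in> proj_space. L \<subseteq> vtx F (kerd (grad F p))}"
proof -
  let ?S = "{P. star_point d F P}"
  let ?L = "\<lambda>K. {L \<in> proj_space. L \<subseteq> vtx F K}"
  define H where "H = {kerd (grad F p) | p. is_star F p}"
  have d2: "d \<ge> 2" using d by simp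
  have fin: "finite (?L ` H)" using finite_star_hyperplanes[OF hom d] by (simp add: H_def)
  have closed: "closedin zariski C" if "C \<in> ?L ` H" for C
    using that closedin_lines_vtx by (auto simp: H_def)
  have "?S \<subseteq> \<Union>(?L ` H)"
  proof
    fix P assume P: "P \<in> ?S"
    then have "P \<in> proj_space" by (auto simp: star_point_def smooth_point_def proj_zeros_def)
    then obtain v where v: "v \<noteq> 0" "P = vec.span {v}" by (auto simp: proj_space_eq_span)
    then have star: "is_star F v" using P star_point_span[OF hom d2 irr] by blast
    then have "P \<subseteq> vtx F (kerd (grad F v))"
      unfolding v(2) by (subst span_singleton_subset_iff) (auto simp: subspace_vtx subspace_kerd is_star_def)
    then show "P \<in> \<Union>(?L ` H)" using \<open>P \<in> proj_space\<close> star by (auto simp: H_def)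
  qed
  then have "zariski closure_of ?S \<subseteq> \<Union>(?L ` H)"
    using fin closed by (intro closure_of_minimal closedin_Union) auto
  moreover have irr\<Lambda>: "irreducible_subset zariski \<Lambda>" and "\<Lambda> \<subseteq> zariski closure_of ?S"
    using comp by (simp_all add: irreducible_component_def)
  ultimately have "\<Lambda> \<subseteq> \<Union>(?L ` H)" by (rule_tac subset_trans)
  from irreducible_subset_finite_Union[OF irr\<Lambda> fin closed this]
  obtain C where C: "C \<in> ?L ` H" "\<Lambda> \<subseteq> C" ..
  then obtain p where p: "is_star F p" "C = ?L (kerd (grad F p))" by (auto simp: H_def)
  have "p \<in> vtx F (kerd (grad F p))" "grad F p \<noteq> 0" using p(1) by (auto simp: is_star_def)
  moreover from this have "p \<noteq> 0" using grad_0[OF hom d2] by auto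
  ultimately have "irreducible_subset zariski C"
    unfolding p(2) by (intro irreducible_lines_subspace[of _ p] subspace_vtx subspace_kerd)
  moreover have "C \<subseteq> zariski closure_of ?S"
    unfolding p(2) by (rule lines_vtx_subset_closure[OF hom d2 irr p(1)])
  ultimately have "C = \<Lambda>" using comp C(2) unfolding irreducible_component_def by blast
  then show ?thesis using that p by blast
qed

theorem theorem2p5:
  fixes F :: "'n::finite cpoly" and N d :: nat and \<Lambda> :: "(complex ^ 'n) set set"
  assumes "CARD('n) = N + 1"
    and "d \<ge> 3"
    and "homogeneous d F"
    and "irreducible F"
    and "irreducible_component zariski (zariski closure_of {P. star_point d F P}) \<Lambda>"
  shows "\<exists>k. k + 2 \<le> N \<and> linear_subspace k \<Lambda> \<and>
    (\<exists>H. hyperplane H \<and> \<Lambda> \<subseteq> H \<and>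
       is_cone_with_vertex d F H k \<Lambda> \<and>
       (\<forall>P\<in>\<Lambda>. smooth_point F P \<longrightarrow> tangent_hyperplane F P = H) \<and>
       (k + 2 = N \<longrightarrow> section_eq_multiple F H d \<Lambda>))"
proof -
  note hom = assms(3) and irr = assms(4)
  have d2: "d \<ge> 2" and d0: "d > 0" using assms(2) by auto
  obtain p where p: "is_star F p" and \<Lambda>: "\<Lambda> = {L \<in> proj_space. L \<subseteq> vtx F (kerd (grad F p))}"
    using component_star_locus[OF hom assms(2) irr assms(5)] by blast
  define a where "a = grad F p"
  let ?K = "kerd a" and ?W = "vtx F (kerd a)"
  have a0: "a \<noteq> 0" and pW: "p \<in> ?W" using p by (auto simp: is_star_def a_def)
  then have p0: "p \<noteq> 0" using grad_0[OF hom d2] by (auto simp: a_def)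
  have W: "vec.subspace ?W" by (rule subspace_vtx[OF subspace_kerd])
  have WK: "?W \<subseteq> ?K" by (auto simp: vtx_def)
  \<comment> \<open>\<open>F\<close> vanishes on \<open>?W\<close> but not on \<open>?K\<close>, so
    \<open>?W\<close> is a proper subspace of a space of dimension \<open>N\<close>; with
    \<open>vec.dim ?W = k + 1\<close> this yields \<open>k + 2 \<le> N\<close>.\<close>
  obtain z where z: "z \<in> ?K" "ev F z \<noteq> 0"
    using irreducible_not_zero_on_hyperplane[OF hom d2 irr a0] by blast
  then have "z \<notin> ?W" using vtx_zero[OF subspace_kerd _ hom d0] by blast
  then have "?W \<noteq> ?K" using z(1) by blast
  then have "vec.dim ?W < vec.dim ?K"
    using vec.subspace_dim_equal[OF W subspace_kerd WK] by linarith
  moreover have dimK: "vec.dim ?K + 1 = CARD('n)" by (rule dim_kerd[OF a0])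
  \<comment> \<open>The nonzero vector \<open>p\<close> makes the projective dimension
    \<open>k = vec.dim ?W - 1\<close> a natural number.\<close>
  moreover have "vec.dim ?W \<noteq> 0" using pW p0 by auto
  ultimately obtain k where k: "vec.dim ?W = k + 1" "k + 2 \<le> N"
    using assms(1) by (metis Suc_eq_plus1 Suc_leI add_2_eq_Suc' add_right_cancel not0_implies_Suc)
  define H where "H = {L \<in> proj_space. L \<subseteq> ?K}"
  have \<Lambda>': "\<Lambda> = {L \<in> proj_space. L \<subseteq> ?W}" using \<Lambda> by (simp add: a_def)
  have "linear_subspace k \<Lambda>" using W k(1) \<Lambda>' unfolding linear_subspace_def by blast
  moreover have "hyperplane H" using dimK subspace_kerd unfolding hyperplane_def H_def by blast
  moreover have "\<Lambda> \<subseteq> H" using WK by (auto simp: \<Lambda>' H_def)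
  moreover have "is_cone_with_vertex d F H k \<Lambda>"
    unfolding \<Lambda>' H_def by (rule cone_with_vertex[OF hom a0 W order_refl k(1) z])
  moreover have "tangent_hyperplane F P = H" if P: "P \<in> \<Lambda>" "smooth_point F P" for P
  proof -
    obtain w where w: "w \<noteq> 0" "P = vec.span {w}" using P(1) by (auto simp: \<Lambda>' proj_space_eq_span)
    then have "w \<in> ?W" using P(1) W span_singleton_subset_iff by (auto simp: \<Lambda>')
    moreover have "grad F w \<noteq> 0" using P(2) smooth_point_span[OF hom w(1)] w(2) by blast
    ultimately have "kerd (grad F w) = ?K" by (rule vtx_star(1)[OF hom d2 a0])
    then show ?thesis using tangent_hyperplane_span[OF hom w(1)] w(2) by (simp add: H_def)
  qed
  moreover have "section_eq_multiple F H d \<Lambda>" if "k + 2 = N"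
    unfolding \<Lambda>' H_def using assms(1) that
    by (intro section_multiple[OF hom a0 W order_refl k(1) z]) simp
  ultimately show ?thesis using k(2) by blast
qed

end
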